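(* Let $\kappa$ be a regular uncountable cardinal and $\chi$ a cardinal such that $\mathrm{P}_{14}(\kappa,\sqsubseteq,\kappa,\{E^\kappa_{\ge\chi}\})$ holds and $\lambda^{<\chi}<\kappa$ for all $\lambda<\kappa$. If $\theta$ is an infinite cardinal with $\theta^+<\chi$, then there exists a downward-closed $T\subseteq{}^{<\kappa}\kappa$ which is a prolific slim $(\chi,\theta^+)$-free $\kappa$-Souslin tree admitting an injective $\mathcal F^{\mathrm{fin}}_\theta$-ascent path.
   Context: Downward-closed subsets of ${}^{<\kappa}\kappa$ are ordered by $\subsetneq$, height $=\mathrm{dom}$, $T_\alpha=T\cap{}^\alpha\kappa$. Prolific: $x^\frown\langle i\rangle\in T$ for $x\in T_\alpha$, $i<\max\{\omega,\alpha\}$. Slim: $|T_\alpha|\le\max\{|\alpha|,\aleph_0\}$. $\kappa$-Souslin: height $\kappa$, levels of size $<\kappa$, no cofinal branch, no antichain of size $\kappa$. $T^\tau=\{f:\tau\to T\mid\mathrm{ht}\circ f$ constant$\}$; for nonzero $\tau$, $\beta<\kappa$ and distinct $\langle w_i\mid i<\tau\rangle\in{}^\tau T_\beta$, the derived tree $\bigotimes_{i<\tau}w_i^\uparrow$ is the set of $f\in T^\tau$ with each $f(i)$ compatible with $w_i$. $T$ is $(\chi,\eta)$-free if for every nonzero $\tau<\chi$, $\beta<\kappa$, distinct $\langle w_i\mid i<\tau\rangle\in{}^\tau T_\beta$ and every $A\subseteq\bigotimes_{i<\tau}w_i^\uparrow$ of size $\kappa$, there are $\vec x,\vec y\in A$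 with $|\{i<\tau\mid\neg(\vec x(i)\subsetneq\vec y(i))\}|<\eta$. $\mathcal F^{\mathrm{fin}}_\theta=\{Z\subseteq\theta\mid|\theta\setminus Z|<\aleph_0\}$. An $\mathcal F^{\mathrm{fin}}_\theta$-ascent path is $\langle f_\alpha\mid\alpha<\kappa\rangle$, $f_\alpha:\theta\to T_\alpha$, with $\{i\mid f_\alpha(i)\subsetneq f_\beta(i)\}\in\mathcal F^{\mathrm{fin}}_\theta$ for $\alpha<\beta$; injective if some $f_\alpha\restriction I$ is injective with $I\in\mathcal F^{\mathrm{fin}}_\theta$. $E^\kappa_{\ge\chi}=\{\alpha<\kappa\mid\mathrm{cf}(\alpha)\ge\chi\}$. $\mathrm{P}_{14}(\kappa,\sqsubseteq,\kappa,\{S\})$: $\diamondsuit(\kappa)$ holds and there is $\langle C_\alpha\mid\alpha<\kappa\rangle$ with $C_\alpha$ club in $\alpha$ for limit $\alpha$, $C_{\bar\alpha}=C_\alpha\cap\bar\alpha$ for $\bar\alpha\in\mathrm{acc}(C_\alpha)=\{\gamma\in C_\alpha\mid\sup(C_\alpha\cap\gamma)=\gamma>0\}$, and for every sequence $\langle A_i\mid i<\kappa\rangle$ of cofinal subsets of $\kappa$ there are stationarily many $\alpha\in S$ with $\sup\{\beta\in C_\alpha\mid\mathrm{succ}_\omega(C_\alpha\setminus\beta)\subseteq A_i\}=\alpha$ for all $i<\alpha$, where $\mathrm{succ}_\omega(D)=\{\delta\in D\mid0<\mathrm{otp}(D\cap\delta)<\omega\}$. *)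

theory Defs
  imports Main "HOL-Library.Countable_Set"
begin

unbundle cardinal_syntax

text \<open>Conventions.  The regular uncountable cardinal kappa is represented by a
well-ordered type 'a whose order type is kappa: the elements of 'a are the
ordinals below kappa, and every proper initial segment has cardinality less
than that of the whole type.  A node of the tree, i.e. an element of the set of
sequences of length less than kappa with values below kappa, is a partial map
x :: 'a \<rightharpoonup> 'a whose domain is an initial segment {..<alpha}; its
height (dom) is alpha.  Proper extension is strict map inclusion.\<close>

definition kappa_regular_uncountable :: "'a::wellorder itself \<Rightarrow> bool" where
  "kappa_regular_uncountable (_::'a itself) \<longleftrightarrow>
     \<not> countable (UNIV :: 'a set)
   \<and> (\<forall>\<alpha>::'a. |{..<\<alpha>}| <o |UNIV :: 'a set| )
   \<and> (\<forall>X::'a set. (\<forall>\<alpha>. \<exists>x\<in>X. \<alpha> \<le> x) \<longrightarrow> |X| =o |UNIV :: 'a set| )"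

definition sup_eq :: "'a::wellorder set \<Rightarrow> 'a \<Rightarrow> bool" where
  "sup_eq X \<alpha> \<longleftrightarrow> (\<forall>x\<in>X. x \<le> \<alpha>) \<and> (\<forall>\<gamma><\<alpha>. \<exists>x\<in>X. \<gamma> < x)"

definition acc_pt :: "'a::wellorder set \<Rightarrow> 'a \<Rightarrow> bool" where
  "acc_pt X \<alpha> \<longleftrightarrow> (\<exists>\<gamma>. \<gamma> < \<alpha>) \<and> sup_eq (X \<inter> {..<\<alpha>}) \<alpha>"

definition acc :: "'a::wellorder set \<Rightarrow> 'a set" where
  "acc C = {\<gamma>\<in>C. acc_pt C \<gamma>}"

definition is_limit :: "'a::wellorder \<Rightarrow> bool" where
  "is_limit \<alpha> \<longleftrightarrow> (\<exists>\<gamma>. \<gamma> < \<alpha>) \<and> (\<forall>\<beta><\<alpha>. \<exists>\<gamma>. \<beta> < \<gamma> \<and> \<gamma> < \<alpha>)"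

definition club :: "'a::wellorder set \<Rightarrow> bool" where
  "club C \<longleftrightarrow> (\<forall>\<alpha>. \<exists>c\<in>C. \<alpha> < c) \<and> (\<forall>\<alpha>. acc_pt C \<alpha> \<longrightarrow> \<alpha> \<in> C)"

definition stationary :: "'a::wellorder set \<Rightarrow> bool" where
  "stationary S \<longleftrightarrow> (\<forall>C. club C \<longrightarrow> S \<inter> C \<noteq> {})"

definition club_in :: "'a::wellorder set \<Rightarrow> 'a \<Rightarrow> bool" where
  "club_in C \<alpha> \<longleftrightarrow> C \<subseteq> {..<\<alpha>} \<and> sup_eq C \<alpha> \<and> (\<forall>\<gamma><\<alpha>. acc_pt C \<gamma> \<longrightarrow> \<gamma> \<in> C)"

definition diamond :: "'a::wellorder itself \<Rightarrow> bool" where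
  "diamond (_::'a itself) \<longleftrightarrow>
     (\<exists>A :: 'a \<Rightarrow> 'a set. (\<forall>\<alpha>. A \<alpha> \<subseteq> {..<\<alpha>})
        \<and> (\<forall>Z :: 'a set. stationary {\<alpha>. Z \<inter> {..<\<alpha>} = A \<alpha>}))"

definition succ_omega :: "'a::wellorder set \<Rightarrow> 'a set" where
  "succ_omega D = {\<delta>\<in>D. D \<inter> {..<\<delta>} \<noteq> {} \<and> finite (D \<inter> {..<\<delta>})}"

definition P14 :: "'a::wellorder set \<Rightarrow> bool" where
  "P14 S \<longleftrightarrow> diamond TYPE('a) \<and>
     (\<exists>C :: 'a \<Rightarrow> 'a set.
        (\<forall>\<alpha>. is_limit \<alpha> \<longrightarrow> club_in (C \<alpha>) \<alpha>)
      \<and> (\<forall>\<alpha>. \<forall>\<alpha>'\<in>acc (C \<alpha>). C \<alpha>' = C \<alpha> \<inter> {..<\<alpha>'})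
      \<and> (\<forall>A :: 'a \<Rightarrow> 'a set. (\<forall>i. \<forall>\<beta>. \<exists>a\<in>A i. \<beta> < a) \<longrightarrow>
           stationary {\<alpha>\<in>S. \<forall>i<\<alpha>.
              sup_eq {\<beta>\<in>C \<alpha>. succ_omega (C \<alpha> - {..<\<beta>}) \<subseteq> A i} \<alpha>}))"

definition E_ge :: "'c rel \<Rightarrow> 'a::wellorder set" where
  "E_ge \<chi> = {\<alpha>. \<forall>X. X \<subseteq> {..<\<alpha>} \<and> (\<forall>\<beta><\<alpha>. \<exists>x\<in>X. \<beta> \<le> x) \<longrightarrow> \<chi> \<le>o |X| }"

text \<open>lambda^{<chi} < kappa for every cardinal lambda < kappa: the powers
lambda^mu for ordinals mu < chi are bounded by a cardinal below kappa\<close>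
definition small_below :: "'a::wellorder itself \<Rightarrow> 'c rel \<Rightarrow> bool" where
  "small_below (_::'a itself) \<chi> \<longleftrightarrow>
     (\<forall>l::'a. \<exists>\<nu>::'a. \<forall>c\<in>Field \<chi>. |Func (underS \<chi> c) {..<l}| \<le>o |{..<\<nu>}| )"

type_synonym 'a node = "'a \<rightharpoonup> 'a"

definition level :: "'a::wellorder node set \<Rightarrow> 'a \<Rightarrow> 'a node set" where
  "level T \<alpha> = {x\<in>T. dom x = {..<\<alpha>}}"

definition ext_strict :: "'a node \<Rightarrow> 'a node \<Rightarrow> bool" where
  "ext_strict x y \<longleftrightarrow> x \<subseteq>\<^sub>m y \<and> x \<noteq> y"

definition compat :: "'a node \<Rightarrow> 'a node \<Rightarrow> bool" where
  "compat x y \<longleftrightarrow> x \<subseteq>\<^sub>m y \<or> y \<subseteq>\<^sub>m x"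

definition downward_closed_tree :: "'a::wellorder node set \<Rightarrow> bool" where
  "downward_closed_tree T \<longleftrightarrow>
     (\<forall>x\<in>T. \<exists>\<alpha>. dom x = {..<\<alpha>})
   \<and> (\<forall>x\<in>T. \<forall>\<beta>. x |` {..<\<beta>} \<in> T)"

definition prolific :: "'a::wellorder node set \<Rightarrow> bool" where
  "prolific T \<longleftrightarrow> (\<forall>\<alpha>. \<forall>x\<in>level T \<alpha>. \<forall>i.
      (i < \<alpha> \<or> finite {..<i}) \<longrightarrow> x(\<alpha> \<mapsto> i) \<in> T)"

definition slim :: "'a::wellorder node set \<Rightarrow> bool" where
  "slim T \<longleftrightarrow> (\<forall>\<alpha>. |level T \<alpha>| \<le>o |{..<\<alpha>}| \<or> countable (level T \<alpha>))"

definition souslin :: "'a::wellorder node set \<Rightarrow> bool" where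
  "souslin T \<longleftrightarrow>
     (\<forall>\<alpha>. level T \<alpha> \<noteq> {})
   \<and> (\<forall>\<alpha>. |level T \<alpha>| <o |UNIV :: 'a set| )
   \<and> \<not> (\<exists>B\<subseteq>T. (\<forall>x\<in>B. \<forall>y\<in>B. compat x y) \<and> (\<forall>\<alpha>. B \<inter> level T \<alpha> \<noteq> {}))
   \<and> (\<forall>A\<subseteq>T. (\<forall>x\<in>A. \<forall>y\<in>A. x \<noteq> y \<longrightarrow> \<not> compat x y) \<longrightarrow> |A| <o |UNIV :: 'a set| )"

text \<open>The derived tree of w : I \<rightarrow> T_beta, as a set of functions on I
(extensional: undefined outside I)\<close>
definition derived_tree :: "'a::wellorder node set \<Rightarrow> 'c set \<Rightarrow> ('c \<Rightarrow> 'a node) \<Rightarrow> ('c \<Rightarrow> 'a node) set" where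
  "derived_tree T I w = {f \<in> Func I T. (\<exists>\<alpha>. \<forall>i\<in>I. dom (f i) = {..<\<alpha>}) \<and> (\<forall>i\<in>I. compat (f i) (w i))}"

text \<open>(chi, eta)-free with eta = theta^+; index sets of cardinality < chi are
taken inside Field chi\<close>
definition free :: "'a::wellorder node set \<Rightarrow> 'c rel \<Rightarrow> 'd rel \<Rightarrow> bool" where
  "free T \<chi> \<eta> \<longleftrightarrow> (\<forall>I \<beta> w A. I \<subseteq> Field \<chi> \<and> I \<noteq> {} \<and> |I| <o \<chi>
      \<and> (\<forall>i\<in>I. w i \<in> level T \<beta>) \<and> inj_on w I
      \<and> A \<subseteq> derived_tree T I w \<and> |A| =o |UNIV :: 'a set|
      \<longrightarrow> (\<exists>x\<in>A. \<exists>y\<in>A. |{i\<in>I. \<not> ext_strict (x i) (y i)}| <o \<eta>))"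

definition injective_fin_ascent_path :: "'a::wellorder node set \<Rightarrow> 'd set \<Rightarrow> ('a \<Rightarrow> 'd \<Rightarrow> 'a node) \<Rightarrow> bool" where
  "injective_fin_ascent_path T \<Theta> f \<longleftrightarrow>
     (\<forall>\<alpha>. \<forall>i\<in>\<Theta>. f \<alpha> i \<in> level T \<alpha>)
   \<and> (\<forall>\<alpha> \<beta>. \<alpha> < \<beta> \<longrightarrow> finite (\<Theta> - {i\<in>\<Theta>. ext_strict (f \<alpha> i) (f \<beta> i)}))
   \<and> (\<exists>\<alpha> I. I \<subseteq> \<Theta> \<and> finite (\<Theta> - I) \<and> inj_on (f \<alpha>) I)"

end

theory Submission
  imports Defs
begin

text \<open>The tree is built level by level, minimally prolific at successors.  At a limit \<open>\<alpha>\<close>, every node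
  on a level in \<open>C \<alpha>\<close> starts a walk along the ladder \<open>C \<alpha>\<close>, and the limits of these walks form level
  \<open>\<alpha>\<close>; coherence of the ladders guarantees that a walk is still in the tree when it passes an
  accumulation point of the ladder.  At a successor point \<open>\<beta>\<close> of the ladder with predecessor \<open>p\<close>,
  diamond suggests a family of walks and a subset of a derived tree; if some element of the
  latter lies above the positions of these walks on level \<open>p\<close>, the walks are steered above it.
  The other walks stay on the ascent path whenever they are on it.

  Since steering takes at most finitely many walks off the ascent path at each step, the walks started
  on the path agree with it, modulo finite sets, at every point of the ladder, and their limits
  continue the path.  Conversely, let \<open>\<alpha>\<close> have cofinality at least \<open>\<chi>\<close> and be hit by the relevant
  guesses.  Fewer than \<open>\<chi>\<close> nodes on level \<open>\<alpha>\<close> are limits of walks with a common start below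
  \<open>\<alpha>\<close>, so some step of the ladder steers all of them that are not on the path above an element of
  the given set.  This yields freeness, with at most \<open>\<theta>\<close> exceptional coordinates; singleton
  families are steered even on the path, which seals all antichains.\<close>

section \<open>Partial maps\<close>

lemma map_le_restrict_dom: "x \<subseteq>\<^sub>m y \<Longrightarrow> y |` dom x = x"
  by (rule ext) (auto simp: map_le_def restrict_map_def domIff)

lemma map_le_same_dom: "x \<subseteq>\<^sub>m y \<Longrightarrow> dom x = dom y \<Longrightarrow> x = y"
  by (metis map_le_antisym map_le_def)

lemma restrict_map_le: "x |` A \<subseteq>\<^sub>m x"
  by (auto simp: map_le_def)

lemma map_le_common:
  assumes "x \<subseteq>\<^sub>m z" "y \<subseteq>\<^sub>m z" "dom x \<subseteq> dom y"
  shows "x \<subseteq>\<^sub>m y"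
  using assms by (auto simp: map_le_def subset_iff)

text \<open>Each value is read off some member of \<open>X\<close>; on a chain the members agree, so
  the choice is immaterial and this is the union.\<close>

definition map_Union :: "('a \<rightharpoonup> 'b) set \<Rightarrow> 'a \<rightharpoonup> 'b" where
  "map_Union X = (\<lambda>\<xi>. if \<exists>x\<in>X. \<xi> \<in> dom x then (SOME x. x \<in> X \<and> \<xi> \<in> dom x) \<xi> else None)"

lemma dom_map_Union: "dom (map_Union X) = \<Union> (dom ` X)"
proof (rule set_eqI)
  fix \<xi>
  have "\<exists>x\<in>X. \<xi> \<in> dom x \<Longrightarrow> \<xi> \<in> dom (SOME x. x \<in> X \<and> \<xi> \<in> dom x)"
    by (metis (mono_tags, lifting) someI_ex)
  then show "\<xi> \<in> dom (map_Union X) \<longleftrightarrow> \<xi> \<in> \<Union> (dom ` X)"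
    by (auto simp: map_Union_def domIff split: if_splits)
qed

lemma map_Union_upper:
  assumes chain: "\<And>x y. x \<in> X \<Longrightarrow> y \<in> X \<Longrightarrow> x \<subseteq>\<^sub>m y \<or> y \<subseteq>\<^sub>m x" and x: "x \<in> X"
  shows "x \<subseteq>\<^sub>m map_Union X"
  unfolding map_le_def
proof
  fix \<xi> assume xi: "\<xi> \<in> dom x"
  define y where "y = (SOME y. y \<in> X \<and> \<xi> \<in> dom y)"
  have y: "y \<in> X" "\<xi> \<in> dom y"
    unfolding y_def by (rule someI2[of _ x]; use x xi in auto)+
  have "x \<xi> = y \<xi>"
    using chain[OF x y(1)] xi y(2) unfolding map_le_def by metis
  then show "x \<xi> = map_Union X \<xi>"
    using x xi by (auto simp: map_Union_def y_def)
qed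

definition zero_node :: "'a::wellorder \<Rightarrow> 'a node" where
  "zero_node \<alpha> = (\<lambda>\<xi>. if \<xi> < \<alpha> then Some (LEAST x. True) else None)"

lemma dom_zero_node [simp]: "dom (zero_node \<alpha>) = {..<\<alpha>}"
  by (auto simp: zero_node_def split: if_splits)

lemma zero_node_restrict: "\<beta> \<le> \<alpha> \<Longrightarrow> zero_node \<alpha> |` {..<\<beta>} = zero_node \<beta>"
  by (rule ext) (auto simp: zero_node_def restrict_map_def)

section \<open>Predecessors and accumulation points\<close>

text \<open>Here \<beta> need not belong to \<open>D\<close>; with \<open>D = UNIV\<close> it is the
  ordinal successor of \<open>p\<close>.\<close>

definition is_pred :: "'a::wellorder set \<Rightarrow> 'a \<Rightarrow> 'a \<Rightarrow> bool" where
  "is_pred D \<beta> p \<longleftrightarrow> p \<in> D \<and> p < \<beta> \<and> (\<forall>c\<in>D. c < \<beta> \<longrightarrow> c \<le> p)"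

lemma is_pred_unique: "is_pred D \<beta> p \<Longrightarrow> is_pred D \<beta> q \<Longrightarrow> p = q"
  unfolding is_pred_def by (meson order_antisym)

lemma the_is_pred: "is_pred D \<beta> p \<Longrightarrow> (THE p. is_pred D \<beta> p) = p"
  by (rule the_equality) (auto intro: is_pred_unique)

lemma zero_succ_limit:
  obtains "\<And>\<gamma>::'a::wellorder. \<not> \<gamma> < \<alpha>" | p where "is_pred UNIV \<alpha> p" | "is_limit \<alpha>"
proof (cases "\<exists>p. is_pred UNIV \<alpha> p \<or> is_limit \<alpha>")
  case False
  then have "\<not> \<gamma> < \<alpha>" for \<gamma>
    by (metis UNIV_I is_limit_def is_pred_def not_le)
  then show ?thesis using that by blast
qed (use that in blast)

lemma is_limit_no_pred: "is_limit \<alpha> \<Longrightarrow> \<not> is_pred UNIV \<alpha> p"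
  unfolding is_limit_def is_pred_def by (meson UNIV_I not_le)

lemma club_in_no_pred: "club_in D \<alpha> \<Longrightarrow> \<not> is_pred D \<alpha> p"
  unfolding club_in_def is_pred_def sup_eq_def by (meson leD lessThan_iff subsetD)

lemma acc_pt_limit: "acc_pt D \<alpha> \<Longrightarrow> is_limit \<alpha>"
  unfolding acc_pt_def sup_eq_def is_limit_def by auto

text \<open>Otherwise the supremum \<open>s\<close> of the part of \<open>D\<close> below \<epsilon>
  is itself below \<epsilon>. If it lies in \<open>D\<close>, it is a predecessor of \<epsilon>; if
  not, it is an accumulation point below \<alpha> omitted by the closed set
  \<open>D\<close>.\<close>

lemma club_in_acc_or_pred:
  assumes D: "club_in D \<alpha>" and \<epsilon>: "\<epsilon> \<le> \<alpha>" and \<delta>: "\<delta> \<in> D" "\<delta> < \<epsilon>"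
    and np: "\<And>p. \<not> is_pred D \<epsilon> p"
  shows "acc_pt D \<epsilon>"
proof (rule ccontr)
  assume "\<not> acc_pt D \<epsilon>"
  then have "\<exists>\<gamma><\<epsilon>. \<forall>x\<in>D \<inter> {..<\<epsilon>}. \<not> \<gamma> < x"
    using \<delta>(2) unfolding acc_pt_def sup_eq_def by (meson IntE lessThan_iff less_imp_le)
  then obtain \<gamma> where \<gamma>: "\<gamma> < \<epsilon>" "\<And>x. x \<in> D \<Longrightarrow> x < \<epsilon> \<Longrightarrow> x \<le> \<gamma>"
    by (auto simp: not_less)
  define s where "s = (LEAST s. \<forall>x\<in>D. x < \<epsilon> \<longrightarrow> x \<le> s)"
  have s: "\<forall>x\<in>D. x < \<epsilon> \<longrightarrow> x \<le> s"
    unfolding s_def by (rule LeastI[of _ \<gamma>]) (use \<gamma> in auto)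
  have s\<gamma>: "s \<le> \<gamma>"
    unfolding s_def by (rule Least_le) (use \<gamma> in auto)
  have "s \<notin> D"
  proof
    assume "s \<in> D"
    then have "is_pred D \<epsilon> s" using s le_less_trans[OF s\<gamma> \<gamma>(1)] by (simp add: is_pred_def)
    then show False using np by blast
  qed
  have "acc_pt D s"
    unfolding acc_pt_def sup_eq_def
  proof (intro conjI ballI allI impI)
    show "\<exists>\<gamma>. \<gamma> < s" using \<delta> s \<open>s \<notin> D\<close> by (metis order_le_imp_less_or_eq)
    fix \<gamma>' assume "\<gamma>' < s"
    then have "\<not> (\<forall>x\<in>D. x < \<epsilon> \<longrightarrow> x \<le> \<gamma>')"
      unfolding s_def using not_less_Least by blast
    then obtain x where "x \<in> D" "x < \<epsilon>" "\<gamma>' < x" by (auto simp: not_le)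
    then show "\<exists>x\<in>D \<inter> {..<s}. \<gamma>' < x"
      using s \<open>s \<notin> D\<close> by (metis IntI lessThan_iff order_le_imp_less_or_eq)
  qed auto
  moreover have "s < \<alpha>" using s\<gamma> \<gamma>(1) \<epsilon> by simp
  ultimately show False using D \<open>s \<notin> D\<close> by (auto simp: club_in_def)
qed

definition below_rel :: "('a::wellorder \<times> 'a) set" where
  "below_rel = {(x, y). x < y}"

lemma wf_below_rel: "wf below_rel"
  unfolding below_rel_def by (rule wf)

section \<open>Walks along a ladder and the levels of the tree\<close>

text \<open>At stage \<open>\<beta>\<close> the diamond sequence is decoded as a family \<open>sq \<beta>\<close> of nodes indexed by
  \<open>Ix \<beta>\<close>, together with the guess \<open>Om \<beta>\<close> for the part below \<open>\<beta>\<close> of a large subset of a derived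
  tree.  The nodes of the ascent path at levels up to \<open>d0\<close> do not depend on the index; they are
  separated at level \<open>d0 + 1\<close> by means of \<open>h\<close>.\<close>

locale tree_construction =
  fixes C :: "'a::wellorder \<Rightarrow> 'a set"
    and Ix :: "'a \<Rightarrow> 'c set" and sq :: "'a \<Rightarrow> 'c \<Rightarrow> 'a node" and Om :: "'a \<Rightarrow> ('c \<Rightarrow> 'a node) set"
    and d0 :: 'a and \<Theta> :: "'d set" and h :: "'d \<Rightarrow> 'a"
  assumes unbounded: "\<exists>b. (a::'a) < b"
    and C_club: "is_limit \<alpha> \<Longrightarrow> club_in (C \<alpha>) \<alpha>"
    and C_coherent: "is_limit \<alpha> \<Longrightarrow> \<alpha>' \<in> acc (C \<alpha>) \<Longrightarrow> C \<alpha>' = C \<alpha> \<inter> {..<\<alpha>'}"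
    and h_less: "i \<in> \<Theta> \<Longrightarrow> h i < d0"
    and h_inj: "inj_on h \<Theta>"
begin

text \<open>Here \<open>g d x\<close> stands for the node on level \<open>p\<close> to which the walk along the ladder \<open>D\<close>
  leads from the node \<open>x\<close> on level \<open>d\<close>, and \<open>P\<close> for the nodes on level \<open>p\<close> reached
  from the ascent path.  Infinite families are not sealed along \<open>P\<close>, so that the walk leaves the
  ascent path for only finitely many indices at each step; the indices lost in this way number at
  most \<open>\<theta>\<close>.\<close>

definition relevant :: "'a \<Rightarrow> 'a node set \<Rightarrow> ('a \<Rightarrow> 'a node \<Rightarrow> 'a node) \<Rightarrow> 'a \<Rightarrow> 'c set" where
  "relevant \<beta> P g d = {\<iota>\<in>Ix \<beta>. finite (Ix \<beta>) \<or> g d (sq \<beta> \<iota>) \<notin> P}"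

text \<open>Each relevant \<open>z \<iota>\<close> must lie strictly below level \<beta>, so that a
  walk can pass through it on its way to level \<beta>; the other coordinates of \<open>z\<close>
  are left free.\<close>

definition seals ::
  "('a \<Rightarrow> 'a node set) \<Rightarrow> 'a set \<Rightarrow> 'a \<Rightarrow> 'a \<Rightarrow> 'a node set \<Rightarrow> ('a \<Rightarrow> 'a node \<Rightarrow> 'a node)
     \<Rightarrow> 'a \<Rightarrow> ('c \<Rightarrow> 'a node) \<Rightarrow> bool" where
  "seals T D \<beta> p P g d z \<longleftrightarrow> d \<in> D \<and> d \<le> p \<and> (\<forall>\<iota>\<in>Ix \<beta>. sq \<beta> \<iota> \<in> T d) \<and> inj_on (sq \<beta>) (Ix \<beta>)
     \<and> z \<in> Om \<beta> \<and> (\<forall>\<iota>\<in>relevant \<beta> P g d. (\<exists>\<epsilon><\<beta>. z \<iota> \<in> T \<epsilon>) \<and> g d (sq \<beta> \<iota>) \<subseteq>\<^sub>m z \<iota>)"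

text \<open>The pair \<open>(d, z)\<close> is chosen independently of \<open>x\<close>: all walks of
  the family must be steered above the same element of the guess. Without such a pair, or off the
  family, the node stays put.\<close>

definition target ::
  "('a \<Rightarrow> 'a node set) \<Rightarrow> 'a set \<Rightarrow> 'a \<Rightarrow> 'a \<Rightarrow> 'a node set \<Rightarrow> ('a \<Rightarrow> 'a node \<Rightarrow> 'a node)
     \<Rightarrow> 'a node \<Rightarrow> 'a node" where
  "target T D \<beta> p P g x =
     (let (d, z) = (SOME (d, z). seals T D \<beta> p P g d z) in
      if seals T D \<beta> p P g d z \<and> (\<exists>\<iota>\<in>relevant \<beta> P g d. g d (sq \<beta> \<iota>) = x)
      then z (SOME \<iota>. \<iota> \<in> relevant \<beta> P g d \<and> g d (sq \<beta> \<iota>) = x) else x)"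

text \<open>The path nodes are separated only above \<open>d0\<close>, so the path is followed from
  there on. Taking the least ladder point makes the start invariant when the ladder is cut at a
  later accumulation point.\<close>

definition path_start :: "'a set \<Rightarrow> 'a \<Rightarrow> bool" where
  "path_start D c \<longleftrightarrow> c \<in> D \<and> d0 < c \<and> (\<forall>c'\<in>D. d0 < c' \<longrightarrow> c \<le> c')"

definition path_nodes ::
  "('a \<Rightarrow> 'd \<Rightarrow> 'a node) \<Rightarrow> 'a set \<Rightarrow> 'a \<Rightarrow> ('a \<Rightarrow> 'a node \<Rightarrow> 'a node) \<Rightarrow> 'a node set" where
  "path_nodes f D p g = {g c (f c i) | c i. path_start D c \<and> c \<le> p \<and> i \<in> \<Theta>}"

text \<open>Path nodes take precedence, which keeps an unsteered walk on the ascent path. The choice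
  depends on \<beta> and the current node \<open>u\<close>, not on how the walk came there.\<close>

definition extend :: "('a \<Rightarrow> 'a node set) \<Rightarrow> ('a \<Rightarrow> 'd \<Rightarrow> 'a node) \<Rightarrow> 'a \<Rightarrow> 'a node \<Rightarrow> 'a node" where
  "extend T f \<beta> u =
     (if \<exists>i\<in>\<Theta>. u \<subseteq>\<^sub>m f \<beta> i then f \<beta> (SOME i. i \<in> \<Theta> \<and> u \<subseteq>\<^sub>m f \<beta> i) else SOME y. y \<in> T \<beta> \<and> u \<subseteq>\<^sub>m y)"

text \<open>For a limit \<open>\<beta>\<close> of \<open>D\<close>, \<open>\<beta>\<close> itself need not belong to \<open>D\<close> and \<open>T \<beta>\<close> is not consulted: this
  case defines the new nodes on level \<open>\<beta>\<close>.\<close>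

definition walk_step ::
  "('a \<Rightarrow> 'a node set) \<Rightarrow> ('a \<Rightarrow> 'd \<Rightarrow> 'a node) \<Rightarrow> 'a set \<Rightarrow> ('a \<Rightarrow> 'a \<Rightarrow> 'a node \<Rightarrow> 'a node)
     \<Rightarrow> 'a \<Rightarrow> 'a \<Rightarrow> 'a node \<Rightarrow> 'a node" where
  "walk_step T f D g \<beta> d x =
     (if \<beta> \<le> d then x
      else if \<exists>p. is_pred D \<beta> p \<and> d \<le> p then
        let p = (THE p. is_pred D \<beta> p)
        in extend T f \<beta> (target T D \<beta> p (path_nodes f D p (g p)) (g p) (g p d x))
      else map_Union {g \<epsilon> d x | \<epsilon>. \<epsilon> \<in> D \<and> d \<le> \<epsilon> \<and> \<epsilon> < \<beta>})"

definition walk ::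
  "('a \<Rightarrow> 'a node set) \<Rightarrow> ('a \<Rightarrow> 'd \<Rightarrow> 'a node) \<Rightarrow> 'a set \<Rightarrow> 'a \<Rightarrow> 'a \<Rightarrow> 'a node \<Rightarrow> 'a node" where
  "walk T f D = wfrec below_rel (walk_step T f D)"

text \<open>This congruence justifies the recursion for walks and, through \<open>walk_cong\<close>,
  the recursion for levels and the comparison of coherent ladders. Level \<beta> itself is consulted
  only at a successor step, hence the alternative in \<open>top\<close>.\<close>

lemma walk_step_cong:
  assumes T: "\<And>\<epsilon>. \<epsilon> < \<beta> \<Longrightarrow> T \<epsilon> = T' \<epsilon> \<and> f \<epsilon> = f' \<epsilon> \<and> g \<epsilon> = g' \<epsilon>"
    and D: "D \<inter> {..<\<beta>} = D' \<inter> {..<\<beta>}"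
    and top: "(T \<beta> = T' \<beta> \<and> f \<beta> = f' \<beta>) \<or> (\<forall>p. \<not> is_pred D \<beta> p)"
  shows "walk_step T f D g \<beta> = walk_step T' f' D' g' \<beta>"
proof (rule ext, rule ext)
  fix d x
  have D': "c \<in> D \<longleftrightarrow> c \<in> D'" if "c < \<beta>" for c using D that by blast
  have pred: "is_pred D \<beta> = is_pred D' \<beta>"
    unfolding is_pred_def fun_eq_iff using D' by blast
  have U: "{g \<epsilon> d x | \<epsilon>. \<epsilon> \<in> D \<and> d \<le> \<epsilon> \<and> \<epsilon> < \<beta>} = {g' \<epsilon> d x | \<epsilon>. \<epsilon> \<in> D' \<and> d \<le> \<epsilon> \<and> \<epsilon> < \<beta>}"
    by (intro Collect_cong ex_cong1) (use T D' in auto)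
  have "extend T f \<beta> (target T D \<beta> p (path_nodes f D p (g p)) (g p) (g p d x))
      = extend T' f' \<beta> (target T' D' \<beta> p (path_nodes f' D' p (g' p)) (g' p) (g' p d x))"
    if p: "is_pred D \<beta> p" for p
  proof -
    have p\<beta>: "p < \<beta>" using p by (simp add: is_pred_def)
    have top': "T \<beta> = T' \<beta>" "f \<beta> = f' \<beta>" using top p by blast+
    have gp: "g p = g' p" using T p\<beta> by blast
    have ps: "path_start D c \<longleftrightarrow> path_start D' c" if "c \<le> p" for c
    proof -
      \<comment> \<open>Ladder points from \<beta> on exceed \<open>c\<close> anyway, so minimality
        is decided below \<beta>, where the ladders agree.\<close>
      have "path_start E c \<longleftrightarrow> c \<in> E \<and> d0 < c \<and> (\<forall>c'. c' < \<beta> \<longrightarrow> c' \<in> E \<longrightarrow> d0 < c' \<longrightarrow> c \<le> c')" for E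
        unfolding path_start_def using that p\<beta> by (metis le_less_trans less_imp_le not_le)
      then show ?thesis using that p\<beta> D'[of c] D' by simp
    qed
    have fc: "f c = f' c" "T c = T' c" "c \<in> D \<longleftrightarrow> c \<in> D'" if "c \<le> p" for c
      using that p\<beta> T[of c] D'[of c] by auto
    have P: "path_nodes f D p (g' p) = path_nodes f' D' p (g' p)"
      unfolding path_nodes_def by (intro Collect_cong ex_cong1) (use ps fc in auto)
    have T\<beta>: "(\<exists>\<epsilon><\<beta>. w \<in> T \<epsilon>) \<longleftrightarrow> (\<exists>\<epsilon><\<beta>. w \<in> T' \<epsilon>)" for w using T by auto
    have "seals T D \<beta> p P (g' p) d z = seals T' D' \<beta> p P (g' p) d z" for P d z
      unfolding seals_def T\<beta> by (cases "d \<le> p") (simp_all add: fc)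
    then have "seals T D \<beta> p P (g' p) = seals T' D' \<beta> p P (g' p)" for P
      by (intro ext) simp
    then have "target T D \<beta> p P (g p) y = target T' D' \<beta> p P (g' p) y" for P y
      unfolding target_def gp by simp
    then show ?thesis unfolding extend_def top' gp P by simp
  qed
  then show "walk_step T f D g \<beta> d x = walk_step T' f' D' g' \<beta> d x"
    unfolding walk_step_def U pred by (auto simp: Let_def the_is_pred)
qed

lemma walk_unfold: "walk T f D \<beta> = walk_step T f D (walk T f D) \<beta>"
proof -
  have "walk T f D \<beta> = walk_step T f D (cut (walk T f D) below_rel \<beta>) \<beta>"
    unfolding walk_def by (subst wfrec[OF wf_below_rel]) simp
  also have "\<dots> = walk_step T f D (walk T f D) \<beta>"
    by (rule walk_step_cong) (auto simp: cut_def below_rel_def)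
  finally show ?thesis .
qed

text \<open>When \<alpha> has no predecessor in the ladder, the walk up to \<alpha> is determined by
  the levels strictly below \<alpha>; this is why it may be used to define level \<alpha>.\<close>

lemma walk_cong:
  assumes T: "\<And>\<epsilon>. \<epsilon> < \<alpha> \<Longrightarrow> T \<epsilon> = T' \<epsilon> \<and> f \<epsilon> = f' \<epsilon>"
    and D: "D \<inter> {..<\<alpha>} = D' \<inter> {..<\<alpha>}"
    and np: "\<And>p. \<not> is_pred D \<alpha> p" and le: "\<beta> \<le> \<alpha>"
  shows "walk T f D \<beta> = walk T' f' D' \<beta>"
  using le
proof (induction \<beta> rule: less_induct)
  case (less \<beta>)
  have top: "(T \<beta> = T' \<beta> \<and> f \<beta> = f' \<beta>) \<or> (\<forall>p. \<not> is_pred D \<beta> p)"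
    using T np less.prems by (cases "\<beta> = \<alpha>") auto
  have D\<beta>: "D \<inter> {..<\<beta>} = D' \<inter> {..<\<beta>}"
    using D less.prems by (auto simp: set_eq_iff dest: order.strict_trans2)
  have "T \<epsilon> = T' \<epsilon> \<and> f \<epsilon> = f' \<epsilon> \<and> walk T f D \<epsilon> = walk T' f' D' \<epsilon>" if "\<epsilon> < \<beta>" for \<epsilon>
    using less that T by auto
  then show ?case
    unfolding walk_unfold[of T f D \<beta>] walk_unfold[of T' f' D' \<beta>]
    by (intro walk_step_cong D\<beta> top) blast
qed

definition level_step :: "('a \<Rightarrow> 'a node set \<times> ('d \<Rightarrow> 'a node)) \<Rightarrow> 'a \<Rightarrow> 'a node set \<times> ('d \<Rightarrow> 'a node)" where
  "level_step G \<alpha> =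
     (let T = (\<lambda>\<beta>. fst (G \<beta>)); f = (\<lambda>\<beta>. snd (G \<beta>)) in
      if \<exists>p. is_pred UNIV \<alpha> p then
        let p = (THE p. is_pred UNIV \<alpha> p) in
          ({x(p \<mapsto> i) | x i. x \<in> T p \<and> (i < p \<or> finite {..<i})},
           \<lambda>j. (f p j)(p \<mapsto> if p = d0 then h j else LEAST x. True))
      else if is_limit \<alpha> then
        ({walk T f (C \<alpha>) \<alpha> d x | d x. d \<in> C \<alpha> \<and> x \<in> T d} \<union> (if \<alpha> \<le> d0 then {zero_node \<alpha>} else {}),
         \<lambda>j. if \<alpha> \<le> d0 then zero_node \<alpha>
             else let c = (LEAST c. c \<in> C \<alpha> \<and> d0 < c) in walk T f (C \<alpha>) \<alpha> c (f c j))
      else ({Map.empty}, \<lambda>j. Map.empty))"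

definition lev :: "'a \<Rightarrow> 'a node set \<times> ('d \<Rightarrow> 'a node)" where
  "lev = wfrec below_rel level_step"

abbreviation T :: "'a \<Rightarrow> 'a node set" where "T \<alpha> \<equiv> fst (lev \<alpha>)"
abbreviation f :: "'a \<Rightarrow> 'd \<Rightarrow> 'a node" where "f \<alpha> \<equiv> snd (lev \<alpha>)"
abbreviation br :: "'a set \<Rightarrow> 'a \<Rightarrow> 'a \<Rightarrow> 'a node \<Rightarrow> 'a node" where "br \<equiv> walk T f"


section \<open>Unfolding the recursions, and coherence of walks\<close>

lemma path_start_unique: "path_start D c \<Longrightarrow> path_start D c' \<Longrightarrow> c = c'"
  unfolding path_start_def by (meson order_antisym)

lemma C_less: "is_limit \<alpha> \<Longrightarrow> c \<in> C \<alpha> \<Longrightarrow> c < \<alpha>"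
  using C_club by (auto simp: club_in_def)

lemma C_unbounded: "is_limit \<alpha> \<Longrightarrow> \<beta> < \<alpha> \<Longrightarrow> \<exists>c\<in>C \<alpha>. \<beta> < c"
  using C_club by (auto simp: club_in_def sup_eq_def)

lemma path_start_exists:
  assumes "is_limit \<alpha>" "d0 < \<alpha>"
  shows "path_start (C \<alpha>) (LEAST c. c \<in> C \<alpha> \<and> d0 < c)"
proof -
  obtain c where "c \<in> C \<alpha> \<and> d0 < c" using C_unbounded assms by blast
  then show ?thesis
    unfolding path_start_def by (metis (mono_tags, lifting) LeastI Least_le)
qed

lemma level_step_cong:
  assumes G: "\<And>\<beta>. \<beta> < \<alpha> \<Longrightarrow> G \<beta> = G' \<beta>"
  shows "level_step G \<alpha> = level_step G' \<alpha>"
proof (cases rule: zero_succ_limit[of \<alpha>])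
  case (2 p)
  then have "p < \<alpha>" by (simp add: is_pred_def)
  have ex: "\<exists>p. is_pred UNIV \<alpha> p" using 2 by blast
  show ?thesis
    unfolding level_step_def Let_def the_is_pred[OF 2] using ex G[OF \<open>p < \<alpha>\<close>] by simp
next
  case 3
  have np: "\<nexists>p. is_pred UNIV \<alpha> p" using is_limit_no_pred[OF 3] by blast
  have w: "walk (\<lambda>\<beta>. fst (G \<beta>)) (\<lambda>\<beta>. snd (G \<beta>)) (C \<alpha>) \<alpha> = walk (\<lambda>\<beta>. fst (G' \<beta>)) (\<lambda>\<beta>. snd (G' \<beta>)) (C \<alpha>) \<alpha>"
    by (rule walk_cong[of \<alpha>]) (use G club_in_no_pred[OF C_club[OF 3]] in auto)
  have eq: "G (LEAST c. c \<in> C \<alpha> \<and> d0 < c) = G' (LEAST c. c \<in> C \<alpha> \<and> d0 < c)" if "d0 < \<alpha>"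
    using path_start_exists[OF 3 that] C_less[OF 3] G by (auto simp: path_start_def)
  have S: "{walk (\<lambda>\<beta>. fst (G \<beta>)) (\<lambda>\<beta>. snd (G \<beta>)) (C \<alpha>) \<alpha> d x | d x. d \<in> C \<alpha> \<and> x \<in> fst (G d)}
      = {walk (\<lambda>\<beta>. fst (G' \<beta>)) (\<lambda>\<beta>. snd (G' \<beta>)) (C \<alpha>) \<alpha> d x | d x. d \<in> C \<alpha> \<and> x \<in> fst (G' d)}"
    unfolding w by (intro Collect_cong ex_cong1) (use G C_less[OF 3] in auto)
  have F: "(\<lambda>j. if \<alpha> \<le> d0 then zero_node \<alpha>
      else walk (\<lambda>\<beta>. fst (G \<beta>)) (\<lambda>\<beta>. snd (G \<beta>)) (C \<alpha>) \<alpha> (LEAST c. c \<in> C \<alpha> \<and> d0 < c)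
            (snd (G (LEAST c. c \<in> C \<alpha> \<and> d0 < c)) j))
    = (\<lambda>j. if \<alpha> \<le> d0 then zero_node \<alpha>
      else walk (\<lambda>\<beta>. fst (G' \<beta>)) (\<lambda>\<beta>. snd (G' \<beta>)) (C \<alpha>) \<alpha> (LEAST c. c \<in> C \<alpha> \<and> d0 < c)
            (snd (G' (LEAST c. c \<in> C \<alpha> \<and> d0 < c)) j))"
  proof (cases "\<alpha> \<le> d0")
    case False
    then have "d0 < \<alpha>" by simp
    from eq[OF this] show ?thesis by (simp only: w)
  qed simp
  show ?thesis
    by (simp only: level_step_def Let_def np 3 if_True if_False S F)
qed (auto simp: level_step_def is_pred_def is_limit_def)

lemma lev_unfold: "lev \<alpha> = level_step lev \<alpha>"
proof -
  have "lev \<alpha> = level_step (cut lev below_rel \<alpha>) \<alpha>"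
    unfolding lev_def by (subst wfrec[OF wf_below_rel]) simp
  also have "\<dots> = level_step lev \<alpha>"
    by (rule level_step_cong) (simp add: cut_def below_rel_def)
  finally show ?thesis .
qed

lemma T_zero: "(\<And>\<gamma>. \<not> \<gamma> < \<alpha>) \<Longrightarrow> T \<alpha> = {Map.empty}"
  and f_zero: "(\<And>\<gamma>. \<not> \<gamma> < \<alpha>) \<Longrightarrow> f \<alpha> j = Map.empty"
  by (subst lev_unfold, simp add: level_step_def is_pred_def is_limit_def)+

lemma lev_succ:
  assumes "is_pred UNIV \<alpha> p"
  shows "lev \<alpha> = ({x(p \<mapsto> i) | x i. x \<in> T p \<and> (i < p \<or> finite {..<i})},
           \<lambda>j. (f p j)(p \<mapsto> if p = d0 then h j else LEAST x. True))"
proof -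
  have "\<exists>p. is_pred UNIV \<alpha> p" using assms by blast
  then show ?thesis
    by (subst lev_unfold) (simp only: level_step_def Let_def the_is_pred[OF assms] if_True)
qed

lemma T_succ: "is_pred UNIV \<alpha> p \<Longrightarrow> T \<alpha> = {x(p \<mapsto> i) | x i. x \<in> T p \<and> (i < p \<or> finite {..<i})}"
  and f_succ: "is_pred UNIV \<alpha> p \<Longrightarrow> f \<alpha> j = (f p j)(p \<mapsto> if p = d0 then h j else LEAST x. True)"
  by (simp_all only: lev_succ fst_conv snd_conv)

lemma T_limit: "is_limit \<alpha> \<Longrightarrow>
    T \<alpha> = {br (C \<alpha>) \<alpha> d x | d x. d \<in> C \<alpha> \<and> x \<in> T d} \<union> (if \<alpha> \<le> d0 then {zero_node \<alpha>} else {})"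
  by (subst lev_unfold) (simp add: level_step_def is_limit_no_pred Let_def)

lemma f_limit_low: "is_limit \<alpha> \<Longrightarrow> \<alpha> \<le> d0 \<Longrightarrow> f \<alpha> j = zero_node \<alpha>"
  by (subst lev_unfold) (simp add: level_step_def is_limit_no_pred Let_def)

lemma f_limit:
  assumes "is_limit \<alpha>" "d0 < \<alpha>" "path_start (C \<alpha>) c"
  shows "f \<alpha> j = br (C \<alpha>) \<alpha> c (f c j)"
  using path_start_unique[OF assms(3) path_start_exists[OF assms(1,2)]] assms(1,2)
  by (subst lev_unfold) (auto simp: level_step_def is_limit_no_pred Let_def)

lemma br_self: "br D \<delta> \<delta> x = x"
  by (simp add: walk_unfold[of T f D \<delta>] walk_step_def)

lemma br_succ:
  assumes "is_pred D \<beta> p" "\<delta> \<le> p"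
  shows "br D \<beta> \<delta> x =
    extend T f \<beta> (target T D \<beta> p (path_nodes f D p (br D p)) (br D p) (br D p \<delta> x))"
proof -
  have "\<not> \<beta> \<le> \<delta>" using assms by (auto simp: is_pred_def)
  then show ?thesis
    using assms by (subst walk_unfold) (auto simp: walk_step_def the_is_pred)
qed

lemma br_limit:
  assumes "\<delta> < \<beta>" "\<And>p. \<not> is_pred D \<beta> p"
  shows "br D \<beta> \<delta> x = map_Union {br D \<epsilon> \<delta> x | \<epsilon>. \<epsilon> \<in> D \<and> \<delta> \<le> \<epsilon> \<and> \<epsilon> < \<beta>}"
  using assms by (subst walk_unfold) (auto simp: walk_step_def)

text \<open>An accumulation point \<epsilon> has no predecessor in either ladder, and the ladders
  agree below it. Hence the position of the long walk at \<epsilon> is a limit already taken when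
  level \<epsilon> was built.\<close>

lemma br_coherent:
  assumes "is_limit \<alpha>" "\<epsilon> \<in> acc (C \<alpha>)" "\<beta> \<le> \<epsilon>"
  shows "br (C \<alpha>) \<beta> = br (C \<epsilon>) \<beta>"
proof (rule walk_cong[of \<epsilon>])
  have lim: "is_limit \<epsilon>" using assms(2) acc_pt_limit by (auto simp: acc_def)
  show eq: "C \<alpha> \<inter> {..<\<epsilon>} = C \<epsilon> \<inter> {..<\<epsilon>}" using C_coherent[OF assms(1,2)] by auto
  fix p show "\<not> is_pred (C \<alpha>) \<epsilon> p"
    using club_in_no_pred[OF C_club[OF lim], of p] eq unfolding is_pred_def by blast
qed (use assms in auto)

section \<open>Induction along the levels: walks stay inside the tree\<close>

lemma target_cases:
  assumes "x \<in> T p" "p < \<beta>"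
  shows "x \<subseteq>\<^sub>m target T D \<beta> p P g x \<and> (\<exists>\<epsilon><\<beta>. target T D \<beta> p P g x \<in> T \<epsilon>)"
proof -
  obtain d z where dz: "(SOME (d, z). seals T D \<beta> p P g d z) = (d, z)" by (metis surj_pair)
  show ?thesis
  proof (cases "seals T D \<beta> p P g d z \<and> (\<exists>\<iota>\<in>relevant \<beta> P g d. g d (sq \<beta> \<iota>) = x)")
    case True
    define \<iota> where "\<iota> = (SOME \<iota>. \<iota> \<in> relevant \<beta> P g d \<and> g d (sq \<beta> \<iota>) = x)"
    have "\<iota> \<in> relevant \<beta> P g d \<and> g d (sq \<beta> \<iota>) = x"
      unfolding \<iota>_def by (rule someI_ex) (use True in blast)
    moreover have "target T D \<beta> p P g x = z \<iota>"
      unfolding target_def dz using True by (simp add: \<iota>_def)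
    ultimately show ?thesis
      using True by (auto simp: seals_def)
  next
    case False
    then have "target T D \<beta> p P g x = x" by (simp only: target_def dz Let_def prod.case if_False)
    then show ?thesis using assms by auto
  qed
qed

text \<open>The induction hypothesis for the levels. That nodes extend to every higher level keeps
  walks from getting stuck; the last clause carries the common initial part of the ascent
  path.\<close>

definition level_ok :: "'a \<Rightarrow> bool" where
  "level_ok \<alpha> \<longleftrightarrow> (\<forall>x\<in>T \<alpha>. dom x = {..<\<alpha>}) \<and> (\<forall>x\<in>T \<alpha>. \<forall>\<beta><\<alpha>. x |` {..<\<beta>} \<in> T \<beta>)
     \<and> (\<forall>\<beta><\<alpha>. \<forall>x\<in>T \<beta>. \<exists>y\<in>T \<alpha>. x \<subseteq>\<^sub>m y) \<and> (\<forall>i\<in>\<Theta>. f \<alpha> i \<in> T \<alpha>)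
     \<and> (\<alpha> \<le> d0 \<longrightarrow> zero_node \<alpha> \<in> T \<alpha> \<and> (\<forall>i. f \<alpha> i = zero_node \<alpha>))"

lemma
  assumes "level_ok \<alpha>"
  shows level_ok_dom: "x \<in> T \<alpha> \<Longrightarrow> dom x = {..<\<alpha>}"
    and level_ok_restrict: "x \<in> T \<alpha> \<Longrightarrow> \<beta> < \<alpha> \<Longrightarrow> x |` {..<\<beta>} \<in> T \<beta>"
    and level_ok_extension: "\<beta> < \<alpha> \<Longrightarrow> x \<in> T \<beta> \<Longrightarrow> \<exists>y\<in>T \<alpha>. x \<subseteq>\<^sub>m y"
    and level_ok_path: "i \<in> \<Theta> \<Longrightarrow> f \<alpha> i \<in> T \<alpha>"
  using assms unfolding level_ok_def by blast+

lemma extend_ok: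
  assumes "level_ok \<beta>" "u \<in> T \<epsilon>" "\<epsilon> < \<beta>"
  shows "extend T f \<beta> u \<in> T \<beta> \<and> u \<subseteq>\<^sub>m extend T f \<beta> u"
proof (cases "\<exists>i\<in>\<Theta>. u \<subseteq>\<^sub>m f \<beta> i")
  case True
  then have "(SOME i. i \<in> \<Theta> \<and> u \<subseteq>\<^sub>m f \<beta> i) \<in> \<Theta> \<and> u \<subseteq>\<^sub>m f \<beta> (SOME i. i \<in> \<Theta> \<and> u \<subseteq>\<^sub>m f \<beta> i)"
    by (metis (mono_tags, lifting) someI_ex)
  then show ?thesis using True assms(1) by (simp add: extend_def level_ok_def)
next
  case False
  have "\<exists>y. y \<in> T \<beta> \<and> u \<subseteq>\<^sub>m y" using level_ok_extension[OF assms(1,3,2)] by blast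
  from someI_ex[OF this] show ?thesis using False by (simp add: extend_def)
qed

lemma br_step_ok:
  assumes "level_ok \<beta>" "is_pred D \<beta> p" "\<delta> \<le> p" "br D p \<delta> x \<in> T p"
  shows "br D \<beta> \<delta> x \<in> T \<beta> \<and> br D p \<delta> x \<subseteq>\<^sub>m br D \<beta> \<delta> x"
proof -
  let ?t = "target T D \<beta> p (path_nodes f D p (br D p)) (br D p) (br D p \<delta> x)"
  have "p < \<beta>" using assms(2) by (simp add: is_pred_def)
  from target_cases[OF assms(4) this] obtain \<epsilon>
    where "br D p \<delta> x \<subseteq>\<^sub>m ?t" "\<epsilon> < \<beta>" "?t \<in> T \<epsilon>" by blast
  then show ?thesis
    unfolding br_succ[OF assms(2,3)] using extend_ok[OF assms(1)] map_le_trans by blast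
qed

lemma br_chain_limit:
  assumes "\<delta> < \<beta>" "\<And>p. \<not> is_pred D \<beta> p"
    and mono: "\<And>\<epsilon> \<epsilon>'. \<epsilon> \<in> D \<Longrightarrow> \<epsilon>' \<in> D \<Longrightarrow> \<delta> \<le> \<epsilon>' \<Longrightarrow> \<epsilon>' \<le> \<epsilon> \<Longrightarrow> \<epsilon> < \<beta> \<Longrightarrow> br D \<epsilon>' \<delta> x \<subseteq>\<^sub>m br D \<epsilon> \<delta> x"
    and "\<epsilon> \<in> D" "\<delta> \<le> \<epsilon>" "\<epsilon> < \<beta>"
  shows "br D \<epsilon> \<delta> x \<subseteq>\<^sub>m br D \<beta> \<delta> x"
  unfolding br_limit[OF assms(1,2)]
proof (rule map_Union_upper)
  fix y y' assume "y \<in> {br D \<epsilon> \<delta> x | \<epsilon>. \<epsilon> \<in> D \<and> \<delta> \<le> \<epsilon> \<and> \<epsilon> < \<beta>}" "y' \<in> {br D \<epsilon> \<delta> x | \<epsilon>. \<epsilon> \<in> D \<and> \<delta> \<le> \<epsilon> \<and> \<epsilon> < \<beta>}"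
  then show "y \<subseteq>\<^sub>m y' \<or> y' \<subseteq>\<^sub>m y"
    using mono by (smt (verit) linear mem_Collect_eq)
qed (use assms in blast)

text \<open>Only levels below \<alpha> are assumed well formed, so this is available while level
  \<alpha> is being verified. The critical case is an accumulation point of the ladder, settled by
  coherence.\<close>

lemma br_level:
  assumes lim: "is_limit \<alpha>" and ok: "\<And>\<beta>. \<beta> < \<alpha> \<Longrightarrow> level_ok \<beta>"
    and \<delta>: "\<delta> \<in> C \<alpha>" "x \<in> T \<delta>"
    and \<epsilon>: "\<epsilon> \<in> C \<alpha>" "\<delta> \<le> \<epsilon>"
  shows "br (C \<alpha>) \<epsilon> \<delta> x \<in> T \<epsilon> \<and>
    (\<forall>\<epsilon>'\<in>C \<alpha>. \<delta> \<le> \<epsilon>' \<longrightarrow> \<epsilon>' \<le> \<epsilon> \<longrightarrow> br (C \<alpha>) \<epsilon>' \<delta> x \<subseteq>\<^sub>m br (C \<alpha>) \<epsilon> \<delta> x)"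
  using \<epsilon>
proof (induction \<epsilon> rule: less_induct)
  case (less \<epsilon>)
  have \<epsilon>\<alpha>: "\<epsilon> < \<alpha>" using C_less[OF lim less.prems(1)] .
  show ?case
  proof (cases "\<delta> = \<epsilon>")
    case True
    then show ?thesis using \<delta> by (auto simp: br_self)
  next
    case False
    then have \<delta>\<epsilon>: "\<delta> < \<epsilon>" using less.prems by simp
    show ?thesis
    proof (cases "\<exists>p. is_pred (C \<alpha>) \<epsilon> p")
      case True
      then obtain p where p: "is_pred (C \<alpha>) \<epsilon> p" by blast
      then have p': "p \<in> C \<alpha>" "p < \<epsilon>" "\<delta> \<le> p" "\<And>c. c \<in> C \<alpha> \<Longrightarrow> c < \<epsilon> \<Longrightarrow> c \<le> p"
        using \<delta> \<delta>\<epsilon> by (auto simp: is_pred_def)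
      note IH = less.IH[OF p'(2,1,3)]
      note st = br_step_ok[OF ok[OF \<epsilon>\<alpha>] p p'(3) conjunct1[OF IH]]
      show ?thesis
      proof (intro conjI ballI impI)
        fix \<epsilon>' assume "\<epsilon>' \<in> C \<alpha>" "\<delta> \<le> \<epsilon>'" "\<epsilon>' \<le> \<epsilon>"
        then show "br (C \<alpha>) \<epsilon>' \<delta> x \<subseteq>\<^sub>m br (C \<alpha>) \<epsilon> \<delta> x"
          using IH st p'(4)[of \<epsilon>'] by (cases "\<epsilon>' = \<epsilon>") (auto intro: map_le_trans[of _ "br (C \<alpha>) p \<delta> x"])
      qed (use st in blast)
    next
      case False
      then have np: "\<And>p. \<not> is_pred (C \<alpha>) \<epsilon> p" by blast
      have acc: "\<epsilon> \<in> acc (C \<alpha>)"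
        using club_in_acc_or_pred[OF C_club[OF lim] less_imp_le[OF \<epsilon>\<alpha>] \<delta>(1) \<delta>\<epsilon> np] less.prems
        by (simp add: acc_def)
      then have lim\<epsilon>: "is_limit \<epsilon>" using acc_pt_limit by (auto simp: acc_def)
      have "\<delta> \<in> C \<epsilon>" using C_coherent[OF lim acc] \<delta> \<delta>\<epsilon> by simp
      then have "br (C \<epsilon>) \<epsilon> \<delta> x \<in> T \<epsilon>"
        using T_limit[OF lim\<epsilon>] \<delta>(2) by blast
      then have 1: "br (C \<alpha>) \<epsilon> \<delta> x \<in> T \<epsilon>"
        using br_coherent[OF lim acc, of \<epsilon>] by simp
      have 2: "br (C \<alpha>) \<epsilon>' \<delta> x \<subseteq>\<^sub>m br (C \<alpha>) \<epsilon> \<delta> x" if "\<epsilon>' \<in> C \<alpha>" "\<delta> \<le> \<epsilon>'" "\<epsilon>' \<le> \<epsilon>" for \<epsilon>'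
      proof (cases "\<epsilon>' = \<epsilon>")
        case False
        show ?thesis
        proof (rule br_chain_limit[OF \<delta>\<epsilon> np])
          show "br (C \<alpha>) \<zeta>' \<delta> x \<subseteq>\<^sub>m br (C \<alpha>) \<zeta> \<delta> x"
            if "\<zeta> \<in> C \<alpha>" "\<zeta>' \<in> C \<alpha>" "\<delta> \<le> \<zeta>'" "\<zeta>' \<le> \<zeta>" "\<zeta> < \<epsilon>" for \<zeta> \<zeta>'
            using less.IH[of \<zeta>] that by auto
        qed (use that False in auto)
      qed simp
      show ?thesis using 1 2 by blast
    qed
  qed
qed

lemma br_top:
  assumes lim: "is_limit \<alpha>" and ok: "\<And>\<beta>. \<beta> < \<alpha> \<Longrightarrow> level_ok \<beta>"
    and \<delta>: "\<delta> \<in> C \<alpha>" "x \<in> T \<delta>"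
  shows "dom (br (C \<alpha>) \<alpha> \<delta> x) = {..<\<alpha>}"
    and "\<epsilon> \<in> C \<alpha> \<Longrightarrow> \<delta> \<le> \<epsilon> \<Longrightarrow> br (C \<alpha>) \<epsilon> \<delta> x \<subseteq>\<^sub>m br (C \<alpha>) \<alpha> \<delta> x"
proof -
  note lv = br_level[OF lim ok \<delta>]
  have \<delta>\<alpha>: "\<delta> < \<alpha>" using C_less[OF lim \<delta>(1)] .
  note np = club_in_no_pred[OF C_club[OF lim]]
  have d: "dom (br (C \<alpha>) \<epsilon> \<delta> x) = {..<\<epsilon>}" if "\<epsilon> \<in> C \<alpha>" "\<delta> \<le> \<epsilon>" for \<epsilon>
    using lv[OF _ that] ok[OF C_less[OF lim that(1)]] by (auto simp: level_ok_def)
  have ex: "\<exists>\<epsilon>\<in>C \<alpha>. \<delta> \<le> \<epsilon> \<and> \<epsilon> < \<alpha> \<and> \<xi> < \<epsilon>" if "\<xi> < \<alpha>" for \<xi>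
    using C_unbounded[OF lim, of "max \<delta> \<xi>"] C_less[OF lim] \<delta>\<alpha> that by (auto intro: less_imp_le)
  have "dom (br (C \<alpha>) \<alpha> \<delta> x) = (\<Union>\<epsilon>\<in>{\<epsilon>\<in>C \<alpha>. \<delta> \<le> \<epsilon> \<and> \<epsilon> < \<alpha>}. {..<\<epsilon>})"
    unfolding br_limit[OF \<delta>\<alpha> np] dom_map_Union using d by (simp add: setcompr_eq_image)
  also have "\<dots> = {..<\<alpha>}"
  proof (rule set_eqI)
    show "\<xi> \<in> (\<Union>\<epsilon>\<in>{\<epsilon>\<in>C \<alpha>. \<delta> \<le> \<epsilon> \<and> \<epsilon> < \<alpha>}. {..<\<epsilon>}) \<longleftrightarrow> \<xi> \<in> {..<\<alpha>}" for \<xi>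
      using ex[of \<xi>] by (auto intro: less_trans)
  qed
  finally show "dom (br (C \<alpha>) \<alpha> \<delta> x) = {..<\<alpha>}" .
  show "br (C \<alpha>) \<epsilon> \<delta> x \<subseteq>\<^sub>m br (C \<alpha>) \<alpha> \<delta> x" if "\<epsilon> \<in> C \<alpha>" "\<delta> \<le> \<epsilon>"
    by (rule br_chain_limit[OF \<delta>\<alpha> np]) (use lv that C_less[OF lim] in auto)
qed

lemma level_ok: "level_ok \<alpha>"
proof (induction \<alpha> rule: less_induct)
  case (less \<alpha>)
  note ok = less.IH
  show ?case
  proof (cases rule: zero_succ_limit[of \<alpha>])
    case 1
    then show ?thesis
      by (auto simp: level_ok_def T_zero f_zero zero_node_def)
  next
    case (2 p)
    then have p: "p < \<alpha>" "\<And>c. c < \<alpha> \<Longrightarrow> c \<le> p" by (auto simp: is_pred_def)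
    have okp: "level_ok p" using ok p by blast
    have dom_p: "dom x = {..<p}" if "x \<in> T p" for x using okp that by (simp add: level_ok_def)
    have a: "{..<\<alpha>} = insert p {..<p}" using p by force
    have bot: "finite {..<LEAST x::'a. True}"
      using not_less_Least[of _ "\<lambda>x::'a. True"] by (metis (mono_tags) finite.emptyI lessThan_iff subset_empty subsetI)
    have le: "x \<subseteq>\<^sub>m x(p \<mapsto> i)" if "x \<in> T p" for x i
      using dom_p[OF that] by (auto simp: map_le_def)
    show ?thesis
      unfolding level_ok_def
    proof (intro conjI ballI allI impI)
      fix x assume "x \<in> T \<alpha>"
      then obtain y i where x: "x = y(p \<mapsto> i)" "y \<in> T p" unfolding T_succ[OF 2] by blast
      show "dom x = {..<\<alpha>}" using x dom_p a by simp
      fix \<beta> assume "\<beta> < \<alpha>"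
      then have "\<beta> \<le> p" using p by blast
      then have "x |` {..<\<beta>} = y |` {..<\<beta>}"
        using x by (auto simp: restrict_map_def fun_eq_iff)
      also have "\<dots> \<in> T \<beta>"
      proof (cases "\<beta> = p")
        case True
        then show ?thesis using dom_p[OF x(2)] x(2) by (metis map_le_refl map_le_restrict_dom)
      qed (use okp x \<open>\<beta> \<le> p\<close> in \<open>auto simp: level_ok_def\<close>)
      finally show "x |` {..<\<beta>} \<in> T \<beta>" .
    next
      fix \<beta> x assume "\<beta> < \<alpha>" "x \<in> T \<beta>"
      then obtain y where y: "y \<in> T p" "x \<subseteq>\<^sub>m y"
        using p(2)[of \<beta>] level_ok_extension[OF okp, of \<beta> x]
        by (metis map_le_refl order_le_imp_less_or_eq)
      have "y(p \<mapsto> LEAST x. True) \<in> T \<alpha>" unfolding T_succ[OF 2] using y bot by blast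
      then show "\<exists>y\<in>T \<alpha>. x \<subseteq>\<^sub>m y" using le[OF y(1)] y(2) map_le_trans by blast
    next
      fix i assume "i \<in> \<Theta>"
      then have "f p i \<in> T p" using level_ok_path[OF okp] by blast
      moreover obtain j where "j = (if p = d0 then h i else LEAST x. True)" by blast
      moreover from this have "j < p \<or> finite {..<j}" using h_less[OF \<open>i \<in> \<Theta>\<close>] bot by simp
      ultimately show "f \<alpha> i \<in> T \<alpha>"
        unfolding T_succ[OF 2] f_succ[OF 2] by blast
    next
      assume le: "\<alpha> \<le> d0"
      then have z: "zero_node p \<in> T p" "\<And>i. f p i = zero_node p"
        using okp p by (auto simp: level_ok_def)
      have z': "zero_node \<alpha> = (zero_node p)(p \<mapsto> LEAST x. True)"
      proof (rule ext)
        show "zero_node \<alpha> \<xi> = ((zero_node p)(p \<mapsto> LEAST x. True)) \<xi>" for \<xi>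
          using p(1) p(2)[of \<xi>] by (auto simp: zero_node_def)
      qed
      show "zero_node \<alpha> \<in> T \<alpha>" unfolding T_succ[OF 2] z' using z bot by blast
      show "f \<alpha> i = zero_node \<alpha>" for i
        unfolding f_succ[OF 2] z' using z p le by auto
    qed
  next
    case 3
    note top = br_top[OF 3 ok]
    note lv = br_level[OF 3 ok]
    have z: "zero_node \<alpha> |` {..<\<beta>} \<in> T \<beta>" if "\<beta> < \<alpha>" "\<alpha> \<le> d0" for \<beta>
      using ok[OF that(1)] that by (simp add: level_ok_def zero_node_restrict)
    show ?thesis
      unfolding level_ok_def
    proof (intro conjI ballI allI impI)
      fix x assume "x \<in> T \<alpha>"
      then consider d y where "x = br (C \<alpha>) \<alpha> d y" "d \<in> C \<alpha>" "y \<in> T d" | "x = zero_node \<alpha>" "\<alpha> \<le> d0"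
        unfolding T_limit[OF 3] by (auto split: if_splits)
      note cs = this
      show "dom x = {..<\<alpha>}" using cs by cases (use top in auto)
      fix \<beta> assume \<beta>: "\<beta> < \<alpha>"
      show "x |` {..<\<beta>} \<in> T \<beta>" using cs
      proof cases
        case 1
        have "max \<beta> d < \<alpha>" using \<beta> 1 C_less[OF 3] by auto
        \<comment> \<open>The restriction to \<beta> is read off from the position of the walk on a
          ladder level above \<beta> and \<open>d\<close>, which is already known to be well
          formed.\<close>
        then obtain \<epsilon> where \<epsilon>: "\<epsilon> \<in> C \<alpha>" "\<beta> < \<epsilon>" "d < \<epsilon>" 
          using C_unbounded[OF 3, of "max \<beta> d"] by auto
        let ?u = "br (C \<alpha>) \<epsilon> d y"
        have u: "?u \<in> T \<epsilon>" using lv[OF _ 1(2,3) \<epsilon>(1)] \<epsilon> by auto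
        have ue: "level_ok \<epsilon>" using ok C_less[OF 3 \<epsilon>(1)] .
        have "?u \<subseteq>\<^sub>m x" using top(2)[OF _ 1(2,3) \<epsilon>(1)] \<epsilon> 1 by auto
        then have "x |` {..<\<epsilon>} = ?u" using ue u map_le_restrict_dom[of ?u x] by (auto simp: level_ok_def)
        then have "x |` {..<\<beta>} = ?u |` {..<\<beta>}"
          using \<epsilon>(2) by (auto simp: restrict_map_def fun_eq_iff split: if_splits)
        then show ?thesis using ue u \<epsilon>(2) by (auto simp: level_ok_def)
      qed (use z \<beta> in auto)
    next
      fix \<beta> x assume "\<beta> < \<alpha>" "x \<in> T \<beta>"
      then obtain \<epsilon> where \<epsilon>: "\<epsilon> \<in> C \<alpha>" "\<beta> < \<epsilon>" using C_unbounded[OF 3] by auto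
      then obtain y where y: "y \<in> T \<epsilon>" "x \<subseteq>\<^sub>m y"
        using level_ok_extension[OF ok[OF C_less[OF 3 \<epsilon>(1)]] \<epsilon>(2) \<open>x \<in> T \<beta>\<close>] by blast
      \<comment> \<open>The level \<epsilon> of \<open>y\<close> is on the ladder, so a walk starts
        at \<open>y\<close>; its limit is the extension sought.\<close>
      have "y \<subseteq>\<^sub>m br (C \<alpha>) \<alpha> \<epsilon> y" using top(2)[OF _ \<epsilon>(1) y(1) \<epsilon>(1)] by (simp add: br_self)
      moreover have "br (C \<alpha>) \<alpha> \<epsilon> y \<in> T \<alpha>" unfolding T_limit[OF 3] using \<epsilon> y by blast
      ultimately show "\<exists>y\<in>T \<alpha>. x \<subseteq>\<^sub>m y" using y(2) map_le_trans by blast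
    next
      fix i assume i: "i \<in> \<Theta>"
      show "f \<alpha> i \<in> T \<alpha>"
      proof (cases "\<alpha> \<le> d0")
        case True
        then show ?thesis using f_limit_low[OF 3] T_limit[OF 3] by simp
      next
        case False
        then obtain c where c: "path_start (C \<alpha>) c" using path_start_exists[OF 3] by (auto simp: not_le)
        then have "c \<in> C \<alpha>" by (simp add: path_start_def)
        moreover have "f c i \<in> T c" using ok[OF C_less[OF 3 \<open>c \<in> C \<alpha>\<close>]] i by (simp add: level_ok_def)
        ultimately show ?thesis
          using f_limit[OF 3 _ c] False T_limit[OF 3] by (auto simp: not_le)
      qed
    qed (use T_limit[OF 3] f_limit_low[OF 3] in auto)
  qed
qed


section \<open>Walks in the completed tree\<close>

lemmas T_dom = level_ok_dom[OF level_ok]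
lemmas T_restrict = level_ok_restrict[OF level_ok]
lemmas f_in_T = level_ok_path[OF level_ok]

lemma f_low: "\<alpha> \<le> d0 \<Longrightarrow> f \<alpha> i = zero_node \<alpha>"
  using level_ok[of \<alpha>] by (simp add: level_ok_def)

lemma T_unique: "x \<in> T \<alpha> \<Longrightarrow> x \<in> T \<beta> \<Longrightarrow> \<alpha> = \<beta>"
  using T_dom[of x \<alpha>] T_dom[of x \<beta>] by simp

lemma T_None: "x \<in> T \<alpha> \<Longrightarrow> \<not> \<xi> < \<alpha> \<Longrightarrow> x \<xi> = None"
  using T_dom[of x \<alpha>] by (metis domIff lessThan_iff)

lemma T_eqI: "x \<in> T \<alpha> \<Longrightarrow> y \<in> T \<alpha> \<Longrightarrow> x \<subseteq>\<^sub>m z \<Longrightarrow> y \<subseteq>\<^sub>m z \<Longrightarrow> x = y"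
  by (metis T_dom map_le_restrict_dom)

lemma br_in_T:
  assumes "is_limit \<alpha>" "\<delta> \<in> C \<alpha>" "x \<in> T \<delta>" "\<epsilon> \<in> insert \<alpha> (C \<alpha>)" "\<delta> \<le> \<epsilon>"
  shows "br (C \<alpha>) \<epsilon> \<delta> x \<in> T \<epsilon>"
proof (cases "\<epsilon> = \<alpha>")
  case True
  then show ?thesis using T_limit[OF assms(1)] assms by auto
qed (use br_level[OF assms(1) level_ok assms(2,3)] assms in auto)

lemma br_mono:
  assumes "is_limit \<alpha>" "\<delta> \<in> C \<alpha>" "x \<in> T \<delta>" "\<epsilon> \<in> insert \<alpha> (C \<alpha>)" "\<epsilon>' \<in> insert \<alpha> (C \<alpha>)" "\<delta> \<le> \<epsilon>" "\<epsilon> \<le> \<epsilon>'"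
  shows "br (C \<alpha>) \<epsilon> \<delta> x \<subseteq>\<^sub>m br (C \<alpha>) \<epsilon>' \<delta> x"
proof (cases "\<epsilon> = \<epsilon>'")
  case False
  then have \<epsilon>: "\<epsilon> \<in> C \<alpha>" using assms C_less[OF assms(1)] by (metis insert_iff leD order_le_imp_less_or_eq)
  show ?thesis
  proof (cases "\<epsilon>' = \<alpha>")
    case True
    then show ?thesis using br_top(2)[OF assms(1) level_ok assms(2,3)] \<epsilon> assms by auto
  qed (use br_level[OF assms(1) level_ok assms(2,3)] \<epsilon> assms in auto)
qed simp

lemma br_extends:
  assumes "is_limit \<alpha>" "\<delta> \<in> C \<alpha>" "x \<in> T \<delta>" "\<epsilon> \<in> insert \<alpha> (C \<alpha>)" "\<delta> \<le> \<epsilon>"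
  shows "x \<subseteq>\<^sub>m br (C \<alpha>) \<epsilon> \<delta> x"
  using br_mono[OF assms(1-3) _ assms(4) order_refl assms(5)] assms(2) by (simp add: br_self)

lemma br_inj:
  assumes "is_limit \<alpha>" "\<delta> \<in> C \<alpha>" "x \<in> T \<delta>" "y \<in> T \<delta>" "\<epsilon> \<in> insert \<alpha> (C \<alpha>)" "\<delta> \<le> \<epsilon>"
    "br (C \<alpha>) \<epsilon> \<delta> x = br (C \<alpha>) \<epsilon> \<delta> y"
  shows "x = y"
  using br_extends[OF assms(1,2,3,5,6)] br_extends[OF assms(1,2,4,5,6)] assms(3,4,7) T_eqI by metis

text \<open>A successor step depends on the past only through the current node, and a limit step
  only on cofinally many positions. So a walk restarted at one of its positions continues as before,
  which allows different starts to be replaced by a common later one.\<close>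

lemma br_compose:
  assumes lim: "is_limit \<alpha>" and \<delta>: "\<delta> \<in> C \<alpha>" "x \<in> T \<delta>" and \<epsilon>: "\<epsilon> \<in> C \<alpha>" "\<delta> \<le> \<epsilon>"
    and \<beta>: "\<beta> \<in> insert \<alpha> (C \<alpha>)" "\<epsilon> \<le> \<beta>"
  shows "br (C \<alpha>) \<beta> \<epsilon> (br (C \<alpha>) \<epsilon> \<delta> x) = br (C \<alpha>) \<beta> \<delta> x"
  using \<beta>
proof (induction \<beta> rule: less_induct)
  case (less \<beta>)
  let ?y = "br (C \<alpha>) \<epsilon> \<delta> x"
  have y: "?y \<in> T \<epsilon>" using br_in_T[OF lim \<delta>] \<epsilon> by auto
  show ?case
  proof (cases "\<epsilon> = \<beta>")
    case False
    then have \<epsilon>\<beta>: "\<epsilon> < \<beta>" using less.prems by simp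
    show ?thesis
    proof (cases "\<exists>p. is_pred (C \<alpha>) \<beta> p")
      case True
      then obtain p where p: "is_pred (C \<alpha>) \<beta> p" by blast
      then have p': "p \<in> C \<alpha>" "p < \<beta>" "\<epsilon> \<le> p" "\<delta> \<le> p" using \<epsilon> \<epsilon>\<beta> by (auto simp: is_pred_def)
      then show ?thesis using br_succ[OF p] less.IH[of p] by simp
    next
      case False
      then have np: "\<And>p. \<not> is_pred (C \<alpha>) \<beta> p" by blast
      have \<delta>\<beta>: "\<delta> < \<beta>" using \<epsilon>(2) \<epsilon>\<beta> by simp
      have ub: "br (C \<alpha>) \<zeta> d u \<subseteq>\<^sub>m br (C \<alpha>) \<beta> d u"
        if "d \<in> C \<alpha>" "u \<in> T d" "\<zeta> \<in> C \<alpha>" "d \<le> \<zeta>" "\<zeta> < \<beta>" for \<zeta> d u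
        using br_mono[OF lim that(1,2)] that less.prems by auto
      have "\<exists>\<zeta>\<in>C \<alpha>. \<epsilon> \<le> \<zeta> \<and> \<zeta> < \<beta> \<and> \<xi> < \<zeta>" if "\<xi> < \<beta>" for \<xi>
      proof -
        have "acc_pt (C \<alpha>) \<beta>"
          using club_in_acc_or_pred[OF C_club[OF lim] _ \<epsilon>(1) \<epsilon>\<beta> np] less.prems C_less[OF lim] by force
        moreover have "max \<xi> \<epsilon> < \<beta>" using that \<epsilon>\<beta> by simp
        ultimately obtain \<zeta> where "\<zeta> \<in> C \<alpha>" "\<zeta> < \<beta>" "max \<xi> \<epsilon> < \<zeta>"
          unfolding acc_pt_def sup_eq_def by blast
        then show ?thesis by (intro bexI[of _ \<zeta>]) auto
      qed
      note ex = this
      have in\<beta>: "br (C \<alpha>) \<beta> \<delta> x \<in> T \<beta>" "br (C \<alpha>) \<beta> \<epsilon> ?y \<in> T \<beta>"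
        using br_in_T[OF lim \<delta>] br_in_T[OF lim \<epsilon>(1) y] less.prems \<delta>\<beta> \<epsilon>\<beta> by auto
      have "br (C \<alpha>) \<beta> \<epsilon> ?y \<xi> = br (C \<alpha>) \<beta> \<delta> x \<xi>" if \<xi>: "\<xi> < \<beta>" for \<xi>
      proof -
        obtain \<zeta> where \<zeta>: "\<zeta> \<in> C \<alpha>" "\<epsilon> \<le> \<zeta>" "\<zeta> < \<beta>" "\<xi> < \<zeta>" using ex[OF \<xi>] by blast
        have eq: "br (C \<alpha>) \<zeta> \<epsilon> ?y = br (C \<alpha>) \<zeta> \<delta> x" using less.IH[of \<zeta>] \<zeta> by simp
        have "\<delta> \<le> \<zeta>" using \<zeta> \<epsilon> by simp
        then have dom: "\<xi> \<in> dom (br (C \<alpha>) \<zeta> \<delta> x)"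
          using T_dom[OF br_in_T[OF lim \<delta>, of \<zeta>]] \<zeta> by simp
        have "br (C \<alpha>) \<beta> \<delta> x \<xi> = br (C \<alpha>) \<zeta> \<delta> x \<xi>"
          using ub[OF \<delta> \<zeta>(1) \<open>\<delta> \<le> \<zeta>\<close> \<zeta>(3)] dom by (simp add: map_le_def)
        moreover have "br (C \<alpha>) \<beta> \<epsilon> ?y \<xi> = br (C \<alpha>) \<zeta> \<delta> x \<xi>"
          using ub[OF \<epsilon>(1) y \<zeta>(1,2,3)] dom unfolding eq by (simp add: map_le_def)
        ultimately show ?thesis by simp
      qed
      then show ?thesis
        using T_None[OF in\<beta>(1)] T_None[OF in\<beta>(2)] by (intro ext) metis
    qed
  qed (simp add: br_self)
qed

section \<open>The ascent path\<close>

text \<open>The entry at \<open>d0\<close> records the index of a path node for ever. It yields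
  injectivity above \<open>d0\<close> and lets the index be recovered from the node.\<close>

lemma f_at_d0:
  assumes "d0 < \<alpha>" "i \<in> \<Theta>"
  shows "f \<alpha> i d0 = Some (h i)"
  using assms(1)
proof (induction \<alpha> rule: less_induct)
  case (less \<alpha>)
  show ?case
  proof (cases rule: zero_succ_limit[of \<alpha>])
    case (2 p)
    then have "p < \<alpha>" "d0 \<le> p" using less.prems by (auto simp: is_pred_def)
    then show ?thesis using less.IH[of p] f_succ[OF 2] by auto
  next
    case 3
    then obtain c where c: "path_start (C \<alpha>) c" using path_start_exists less.prems by blast
    then have c': "c \<in> C \<alpha>" "d0 < c" "c < \<alpha>" using C_less[OF 3] by (auto simp: path_start_def)
    have "f c i \<subseteq>\<^sub>m f \<alpha> i"
      unfolding f_limit[OF 3 less.prems c]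
      by (rule br_extends[OF 3 c'(1) f_in_T[OF assms(2)]]) (use c' in auto)
    then show ?thesis using less.IH[OF c'(3,2)] by (metis domI map_le_def)
  qed (use less.prems in blast)
qed

lemma f_inj: "d0 < \<alpha> \<Longrightarrow> inj_on (f \<alpha>) \<Theta>"
proof (rule inj_onI)
  fix i j assume "d0 < \<alpha>" "i \<in> \<Theta>" "j \<in> \<Theta>" "f \<alpha> i = f \<alpha> j"
  then have "h i = h j" using f_at_d0[of \<alpha> i] f_at_d0[of \<alpha> j] by simp
  then show "i = j" by (rule inj_onD[OF h_inj]) fact+
qed

text \<open>The entry at \<open>d0\<close> excludes every other index, so the choice made in
  \<open>extend\<close> is forced.\<close>

lemma extend_path:
  assumes "d0 < p" "d0 < \<beta>" "i \<in> \<Theta>" "f p i \<subseteq>\<^sub>m f \<beta> i"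
  shows "extend T f \<beta> (f p i) = f \<beta> i"
proof -
  have "(SOME j. j \<in> \<Theta> \<and> f p i \<subseteq>\<^sub>m f \<beta> j) = i"
  proof (rule some_equality)
    fix j assume j: "j \<in> \<Theta> \<and> f p i \<subseteq>\<^sub>m f \<beta> j"
    then have "f \<beta> j d0 = f p i d0" using f_at_d0[OF assms(1,3)] by (metis domI map_le_def)
    then have "h j = h i" using f_at_d0[OF assms(1,3)] f_at_d0[OF assms(2)] j by simp
    then show "j = i" by (rule inj_onD[OF h_inj]) (use j assms in auto)
  qed (use assms in blast)
  then show ?thesis unfolding extend_def using assms by auto
qed

text \<open>Sealing moves a path node only if the sealed family is finite, so at most finitely
  many indices leave the path at a single step.\<close>

lemma path_step:
  assumes lim: "is_limit \<alpha>" and c: "path_start (C \<alpha>) c"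
    and p: "is_pred (C \<alpha>) \<beta> p" "c \<le> p"
  shows "finite {i\<in>\<Theta>. br (C \<alpha>) p c (f c i) = f p i \<and> f p i \<subseteq>\<^sub>m f \<beta> i \<and> br (C \<alpha>) \<beta> c (f c i) \<noteq> f \<beta> i}"
    (is "finite ?X")
proof -
  let ?g = "br (C \<alpha>) p"
  let ?P = "path_nodes f (C \<alpha>) p ?g"
  let ?t = "target T (C \<alpha>) \<beta> p ?P ?g"
  have c': "c \<in> C \<alpha>" "d0 < c" "p \<in> C \<alpha>" "p < \<beta>" using c p by (auto simp: path_start_def is_pred_def)
  obtain d z where dz: "(SOME (d, z). seals T (C \<alpha>) \<beta> p ?P ?g d z) = (d, z)" by (metis surj_pair)
  \<comment> \<open>Injectivity turns finitely many steered nodes into finitely many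
    indices.\<close>
  have inj: "inj_on (\<lambda>i. ?g c (f c i)) \<Theta>"
  proof (rule inj_onI)
    fix i j assume ij: "i \<in> \<Theta>" "j \<in> \<Theta>" "?g c (f c i) = ?g c (f c j)"
    then have "f c i = f c j"
      using br_inj[OF lim c'(1) f_in_T f_in_T _ p(2)] c' by blast
    then show "i = j" using f_inj[OF c'(2)] ij by (auto dest: inj_onD)
  qed
  have "finite (Ix \<beta>) \<and> ?g c (f c i) \<in> (\<lambda>\<iota>. ?g d (sq \<beta> \<iota>)) ` Ix \<beta>" if i: "i \<in> ?X" for i
  proof -
    let ?x = "?g c (f c i)"
    have x: "?x = f p i" and iT: "i \<in> \<Theta>" using i by auto
    \<comment> \<open>A path node left in place by \<open>target\<close> would be extended along the
      path.\<close>
    have "?t ?x \<noteq> ?x"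
    proof
      assume "?t ?x = ?x"
      then have "br (C \<alpha>) \<beta> c (f c i) = extend T f \<beta> (f p i)"
        using br_succ[OF p] x by simp
      also have "\<dots> = f \<beta> i"
        by (rule extend_path) (use i c' p(2) in auto)
      finally show False using i by blast
    qed
    then have "\<exists>\<iota>\<in>relevant \<beta> ?P ?g d. ?g d (sq \<beta> \<iota>) = ?x"
      unfolding target_def dz by (auto split: if_splits)
    moreover have "?x \<in> ?P" unfolding path_nodes_def using c p(2) iT by blast
    ultimately show ?thesis unfolding relevant_def by force
  qed
  then have "?X = {} \<or> (finite (Ix \<beta>) \<and> (\<lambda>i. ?g c (f c i)) ` ?X \<subseteq> (\<lambda>\<iota>. ?g d (sq \<beta> \<iota>)) ` Ix \<beta>)"
    by blast
  moreover have "inj_on (\<lambda>i. ?g c (f c i)) ?X" using inj by (rule inj_on_subset) auto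
  ultimately show ?thesis
  proof (elim disjE conjE)
    assume "finite (Ix \<beta>)" "(\<lambda>i. ?g c (f c i)) ` ?X \<subseteq> (\<lambda>\<iota>. ?g d (sq \<beta> \<iota>)) ` Ix \<beta>"
    then have "finite ((\<lambda>i. ?g c (f c i)) ` ?X)" by (meson finite_imageI finite_subset)
    then show ?thesis by (rule finite_imageD) fact
  next
    assume empty: "?X = {}"
    show ?thesis unfolding empty by simp
  qed
qed

text \<open>Finite sets of exceptions could pile up along the ladder, but at an accumulation point
  \<epsilon> coherence makes \<open>f \<epsilon>\<close> the limit of this very walk, and the set of
  exceptions becomes empty. Between accumulation points only finitely many are added per
  step.\<close>

lemma path_walk:
  assumes lim: "is_limit \<alpha>" and c: "path_start (C \<alpha>) c"
    and IH: "\<And>\<gamma> \<epsilon>. \<epsilon> < \<alpha> \<Longrightarrow> \<gamma> < \<epsilon> \<Longrightarrow> finite {i\<in>\<Theta>. \<not> f \<gamma> i \<subseteq>\<^sub>m f \<epsilon> i}"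
    and \<epsilon>: "\<epsilon> \<in> C \<alpha>" "c \<le> \<epsilon>"
  shows "finite {i\<in>\<Theta>. br (C \<alpha>) \<epsilon> c (f c i) \<noteq> f \<epsilon> i}"
  using \<epsilon>
proof (induction \<epsilon> rule: less_induct)
  case (less \<epsilon>)
  have c': "c \<in> C \<alpha>" "d0 < c" using c by (auto simp: path_start_def)
  show ?case
  proof (cases "c = \<epsilon>")
    case False
    then have c\<epsilon>: "c < \<epsilon>" using less.prems by simp
    show ?thesis
    proof (cases "\<exists>p. is_pred (C \<alpha>) \<epsilon> p")
      case True
      then obtain p where p: "is_pred (C \<alpha>) \<epsilon> p" by blast
      then have p': "p \<in> C \<alpha>" "p < \<epsilon>" "c \<le> p" using c' c\<epsilon> by (auto simp: is_pred_def)
      have "{i\<in>\<Theta>. br (C \<alpha>) \<epsilon> c (f c i) \<noteq> f \<epsilon> i} \<subseteq>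
        {i\<in>\<Theta>. br (C \<alpha>) p c (f c i) \<noteq> f p i} \<union> {i\<in>\<Theta>. \<not> f p i \<subseteq>\<^sub>m f \<epsilon> i} \<union>
        {i\<in>\<Theta>. br (C \<alpha>) p c (f c i) = f p i \<and> f p i \<subseteq>\<^sub>m f \<epsilon> i \<and> br (C \<alpha>) \<epsilon> c (f c i) \<noteq> f \<epsilon> i}"
        by blast
      then show ?thesis
        using less.IH[OF p'(2,1,3)] IH[OF C_less[OF lim less.prems(1)] p'(2)] path_step[OF lim c p p'(3)]
        by (meson finite_Un finite_subset)
    next
      case False
      then have np: "\<And>p. \<not> is_pred (C \<alpha>) \<epsilon> p" by blast
      have acc: "\<epsilon> \<in> acc (C \<alpha>)"
        using club_in_acc_or_pred[OF C_club[OF lim] less_imp_le[OF C_less[OF lim less.prems(1)]] c'(1) c\<epsilon> np] less.prems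
        by (simp add: acc_def)
      then have lim\<epsilon>: "is_limit \<epsilon>" using acc_pt_limit by (auto simp: acc_def)
      have "path_start (C \<epsilon>) c" using C_coherent[OF lim acc] c c\<epsilon> by (simp add: path_start_def)
      then have "f \<epsilon> i = br (C \<alpha>) \<epsilon> c (f c i)" for i
        using f_limit[OF lim\<epsilon>] c'(2) c\<epsilon> br_coherent[OF lim acc, of \<epsilon>] by simp
      then show ?thesis by simp
    qed
  qed (simp add: br_self)
qed

lemma f_ascent:
  assumes "\<alpha> < \<beta>"
  shows "finite {i\<in>\<Theta>. \<not> f \<alpha> i \<subseteq>\<^sub>m f \<beta> i}"
  using assms
proof (induction \<beta> arbitrary: \<alpha> rule: less_induct)
  case (less \<beta>)
  show ?case
  proof (cases rule: zero_succ_limit[of \<beta>])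
    case 1
    then show ?thesis using less.prems by blast
  next
    case (2 p)
    then have p: "p < \<beta>" "\<alpha> \<le> p" using less.prems by (auto simp: is_pred_def)
    have "f p i \<subseteq>\<^sub>m f \<beta> i" if "i \<in> \<Theta>" for i
      unfolding f_succ[OF 2] using T_dom[OF f_in_T[OF that, of p]] by (auto simp: map_le_def)
    then have "{i\<in>\<Theta>. \<not> f \<alpha> i \<subseteq>\<^sub>m f \<beta> i} \<subseteq> {i\<in>\<Theta>. \<not> f \<alpha> i \<subseteq>\<^sub>m f p i}"
      using map_le_trans by blast
    moreover have "finite {i\<in>\<Theta>. \<not> f \<alpha> i \<subseteq>\<^sub>m f p i}"
      using less.IH[OF p(1)] p(2) by (cases "\<alpha> = p") auto
    ultimately show ?thesis using finite_subset by blast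
  next
    case 3
    show ?thesis
    proof (cases "\<beta> \<le> d0")
      case True
      then have "f \<alpha> i \<subseteq>\<^sub>m f \<beta> i" for i
        using less.prems by (metis f_low less_le_trans less_imp_le restrict_map_le zero_node_restrict)
      then show ?thesis by simp
    next
      case False
      then have d0: "d0 < \<beta>" by simp
      then obtain c where c: "path_start (C \<beta>) c" using path_start_exists 3 by blast
      then have c': "c \<in> C \<beta>" "c < \<beta>" using C_less[OF 3] by (auto simp: path_start_def)
      then have "max \<alpha> c < \<beta>" using less.prems by simp
      \<comment> \<open>The comparison passes through a ladder level \<epsilon>: modulo finite sets
        \<open>f \<alpha>\<close> is below \<open>f \<epsilon>\<close>, which is the position of the
        walk, and the walk stays below its limit \<open>f \<beta>\<close>.\<close>
      then obtain \<epsilon> where \<epsilon>: "\<epsilon> \<in> C \<beta>" "\<alpha> < \<epsilon>" "c < \<epsilon>" using C_unbounded[OF 3] by fastforce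
      have \<epsilon>\<beta>: "\<epsilon> < \<beta>" using C_less[OF 3 \<epsilon>(1)] .
      have 1: "finite {i\<in>\<Theta>. \<not> f \<alpha> i \<subseteq>\<^sub>m f \<epsilon> i}" by (rule less.IH[OF \<epsilon>\<beta> \<epsilon>(2)])
      have 2: "finite {i\<in>\<Theta>. br (C \<beta>) \<epsilon> c (f c i) \<noteq> f \<epsilon> i}"
        by (rule path_walk[OF 3 c less.IH \<epsilon>(1)]) (use \<epsilon> in auto)
      have "br (C \<beta>) \<epsilon> c (f c i) \<subseteq>\<^sub>m f \<beta> i" if "i \<in> \<Theta>" for i
        unfolding f_limit[OF 3 d0 c] using br_mono[OF 3 c'(1) f_in_T[OF that], of \<epsilon> \<beta>] \<epsilon> \<epsilon>\<beta> by simp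
      then have "{i\<in>\<Theta>. \<not> f \<alpha> i \<subseteq>\<^sub>m f \<beta> i} \<subseteq>
          {i\<in>\<Theta>. \<not> f \<alpha> i \<subseteq>\<^sub>m f \<epsilon> i} \<union> {i\<in>\<Theta>. br (C \<beta>) \<epsilon> c (f c i) \<noteq> f \<epsilon> i}"
        using map_le_trans by fastforce
      then show ?thesis using 1 2 by (meson finite_Un finite_subset)
    qed
  qed
qed

section \<open>Sealing, and the shape of the tree\<close>

text \<open>The given \<open>z\<close> shows only that a seal exists; \<open>target\<close> may have
  chosen another pair. Its first component must still be \<open>d\<close>, because a nonempty family
  determines its level, and its second component is the element returned.\<close>

lemma sealing:
  assumes lim: "is_limit \<alpha>" and p: "is_pred (C \<alpha>) \<beta> p" and d: "d \<in> C \<alpha>" "d \<le> p"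
    and sq: "\<And>\<iota>. \<iota> \<in> Ix \<beta> \<Longrightarrow> sq \<beta> \<iota> \<in> T d" "inj_on (sq \<beta>) (Ix \<beta>)"
    and \<beta>: "\<beta> \<in> C \<alpha>"
    and z: "z \<in> Om \<beta>" "\<And>\<iota>. \<iota> \<in> Ix \<beta> \<Longrightarrow> (\<exists>\<epsilon><\<beta>. z \<iota> \<in> T \<epsilon>) \<and> br (C \<alpha>) p d (sq \<beta> \<iota>) \<subseteq>\<^sub>m z \<iota>"
  shows "\<exists>z\<in>Om \<beta>. \<forall>\<iota>\<in>relevant \<beta> (path_nodes f (C \<alpha>) p (br (C \<alpha>) p)) (br (C \<alpha>) p) d.
    (\<exists>\<epsilon><\<beta>. z \<iota> \<in> T \<epsilon>) \<and> z \<iota> \<subseteq>\<^sub>m br (C \<alpha>) \<beta> d (sq \<beta> \<iota>)"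
proof -
  let ?g = "br (C \<alpha>) p"
  let ?P = "path_nodes f (C \<alpha>) p ?g"
  let ?R = "relevant \<beta> ?P ?g"
  obtain d' z' where dz: "(SOME (d, z). seals T (C \<alpha>) \<beta> p ?P ?g d z) = (d', z')" by (metis surj_pair)
  have "seals T (C \<alpha>) \<beta> p ?P ?g d z"
    using d sq z by (auto simp: seals_def relevant_def)
  then have s': "seals T (C \<alpha>) \<beta> p ?P ?g d' z'"
    using someI_ex[of "\<lambda>(d, z). seals T (C \<alpha>) \<beta> p ?P ?g d z"] dz by auto
  have pC: "p \<in> C \<alpha>" "p < \<beta>" using p by (auto simp: is_pred_def)
  show ?thesis
  proof (intro bexI[of _ z'] ballI)
    show "z' \<in> Om \<beta>" using s' by (simp add: seals_def)
    fix \<iota> assume \<iota>: "\<iota> \<in> ?R d"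
    then have \<iota>I: "\<iota> \<in> Ix \<beta>" by (simp add: relevant_def)
    then have "sq \<beta> \<iota> \<in> T d'" using s' by (simp add: seals_def)
    then have dd: "d' = d" using sq(1)[OF \<iota>I] T_unique by blast
    then have z'\<iota>: "\<exists>\<epsilon><\<beta>. z' \<iota> \<in> T \<epsilon>" using s' \<iota> by (simp add: seals_def)
    let ?x = "?g d (sq \<beta> \<iota>)"
    \<comment> \<open>Distinct members of the family occupy distinct positions, so the position
      determines the index.\<close>
    have "(SOME \<kappa>. \<kappa> \<in> ?R d \<and> ?g d (sq \<beta> \<kappa>) = ?x) = \<iota>"
    proof (rule some_equality)
      fix \<kappa> assume k: "\<kappa> \<in> ?R d \<and> ?g d (sq \<beta> \<kappa>) = ?x"
      then have kI: "\<kappa> \<in> Ix \<beta>" by (simp add: relevant_def)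
      then have "sq \<beta> \<kappa> = sq \<beta> \<iota>"
        using br_inj[OF lim d(1) sq(1)[OF kI] sq(1)[OF \<iota>I] _ d(2)] k pC by blast
      then show "\<kappa> = \<iota>" using sq(2) kI \<iota>I by (auto dest: inj_onD)
    qed (use \<iota> in blast)
    then have t: "target T (C \<alpha>) \<beta> p ?P ?g ?x = z' \<iota>"
      unfolding target_def dz using s' dd \<iota> by auto
    obtain \<epsilon> where "\<epsilon> < \<beta>" "z' \<iota> \<in> T \<epsilon>" using z'\<iota> by blast
    then have "z' \<iota> \<subseteq>\<^sub>m br (C \<alpha>) \<beta> d (sq \<beta> \<iota>)"
      unfolding br_succ[OF p d(2)] t using extend_ok[OF level_ok] by blast
    then show "(\<exists>\<epsilon><\<beta>. z' \<iota> \<in> T \<epsilon>) \<and> z' \<iota> \<subseteq>\<^sub>m br (C \<alpha>) \<beta> d (sq \<beta> \<iota>)" using z'\<iota> by blast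
  qed
qed

section \<open>The tree as a whole: closure, slimness and ascent path\<close>

definition Tree :: "'a node set" where "Tree = (\<Union>\<alpha>. T \<alpha>)"

lemma level_Tree: "level Tree \<alpha> = T \<alpha>"
  unfolding level_def Tree_def using T_dom lessThan_eq_iff by auto

lemma Tree_downward_closed: "downward_closed_tree Tree"
  unfolding downward_closed_tree_def
proof (intro conjI ballI allI)
  fix x assume "x \<in> Tree"
  then obtain \<alpha> where x: "x \<in> T \<alpha>" by (auto simp: Tree_def)
  then show "\<exists>\<alpha>. dom x = {..<\<alpha>}" using T_dom by blast
  fix \<beta>
  show "x |` {..<\<beta>} \<in> Tree"
  proof (cases "\<beta> < \<alpha>")
    case True
    then show ?thesis using T_restrict[OF x] by (auto simp: Tree_def)
  next
    case False
    then have "x \<xi> = None" if "\<not> \<xi> < \<beta>" for \<xi>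
      using T_None[OF x] that False by (metis less_le_trans not_less)
    then have "x |` {..<\<beta>} = x"
      by (auto simp: restrict_map_def fun_eq_iff)
    then show ?thesis using \<open>x \<in> Tree\<close> by simp
  qed
qed

lemma Tree_prolific: "prolific Tree"
  unfolding prolific_def
proof (intro allI ballI impI)
  fix \<alpha> x i assume x: "x \<in> level Tree \<alpha>" and i: "i < \<alpha> \<or> finite {..<i}"
  define \<beta> where "\<beta> = (LEAST \<beta>. \<alpha> < \<beta>)"
  have "is_pred UNIV \<beta> \<alpha>"
    unfolding is_pred_def \<beta>_def using unbounded[of \<alpha>] by (metis LeastI UNIV_I not_le not_less_Least)
  then have "x(\<alpha> \<mapsto> i) \<in> T \<beta>" using x i T_succ unfolding level_Tree by blast
  then show "x(\<alpha> \<mapsto> i) \<in> Tree" by (auto simp: Tree_def)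
qed

text \<open>The disjoint sum with the natural numbers expresses the bound max{|\<alpha>|, aleph_0}
  uniformly. At a limit there are at most |\<alpha>| ladder levels, each supplying at most that many
  starts.\<close>

lemma T_card: "|T \<alpha>| \<le>o |{..<\<alpha>} <+> (UNIV :: nat set)|"
proof (induction \<alpha> rule: less_induct)
  case (less \<alpha>)
  let ?K = "\<lambda>\<alpha>::'a. {..<\<alpha>} <+> (UNIV :: nat set)"
  have inf: "infinite (?K \<alpha>)" for \<alpha> by simp
  have mono: "|?K \<beta>| \<le>o |?K \<alpha>|" if "\<beta> \<le> \<alpha>" for \<beta>
    by (rule card_of_mono1) (use that in auto)
  show ?case
  proof (cases rule: zero_succ_limit[of \<alpha>])
    case 1
    then show ?thesis using T_zero by (simp add: card_of_singl_ordLeq)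
  next
    case (2 p)
    then have p: "p < \<alpha>" by (simp add: is_pred_def)
    let ?I = "{i. i < p \<or> finite {..<i}}"
    \<comment> \<open>A value with finitely many predecessors is determined by their number.\<close>
    have "inj_on (\<lambda>i. card {..<i}) {i::'a. finite {..<i}}"
    proof (rule inj_onI)
      fix i j :: 'a assume ij: "i \<in> {i. finite {..<i}}" "j \<in> {i. finite {..<i}}" "card {..<i} = card {..<j}"
      show "i = j"
      proof (rule linorder_cases[of i j])
        assume "i < j" then have "{..<i} \<subset> {..<j}" by auto
        then show ?thesis using psubset_card_mono[of "{..<j}" "{..<i}"] ij by simp
      next
        assume "j < i" then have "{..<j} \<subset> {..<i}" by auto
        then show ?thesis using psubset_card_mono[of "{..<i}" "{..<j}"] ij by simp
      qed simp
    qed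
    then have "|{i::'a. finite {..<i}}| \<le>o |UNIV :: nat set|"
      using card_of_ordLeq by blast
    then have "|{..<p} <+> {i::'a. finite {..<i}}| \<le>o |?K p|" by (rule card_of_Plus_mono2)
    moreover have "|?I| \<le>o |{..<p} <+> {i::'a. finite {..<i}}|"
      using card_of_Un_Plus_ordLeq[of "{..<p}" "{i. finite {..<i}}"]
      by (simp add: Un_def)
    ultimately have "|?I| \<le>o |?K p|" by (rule ordLeq_transitive[rotated])
    then have I: "|?I| \<le>o |?K \<alpha>|" by (rule ordLeq_transitive[OF _ mono[OF less_imp_le[OF p]]])
    have Tp: "|T p| \<le>o |?K \<alpha>|" by (rule ordLeq_transitive[OF less[OF p] mono[OF less_imp_le[OF p]]])
    have "T \<alpha> = (\<lambda>(x, i). x(p \<mapsto> i)) ` (T p \<times> ?I)" unfolding T_succ[OF 2] by auto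
    then have "|T \<alpha>| \<le>o |T p \<times> ?I|" by (simp only: card_of_image)
    also have "|T p \<times> ?I| \<le>o |?K \<alpha>|"
      by (rule card_of_Sigma_ordLeq_infinite[OF inf Tp]) (use I in blast)
    finally show ?thesis .
  next
    case 3
    let ?U = "\<Union>d\<in>C \<alpha>. (\<lambda>x. br (C \<alpha>) \<alpha> d x) ` T d"
    have U: "|?U| \<le>o |?K \<alpha>|"
    proof (rule card_of_UNION_ordLeq_infinite[OF inf])
      have "|C \<alpha>| \<le>o |{..<\<alpha>}|" using C_less[OF 3] by (intro card_of_mono1) auto
      then show "|C \<alpha>| \<le>o |?K \<alpha>|" using card_of_Plus1 ordLeq_transitive by blast
      show "\<forall>d\<in>C \<alpha>. |(\<lambda>x. br (C \<alpha>) \<alpha> d x) ` T d| \<le>o |?K \<alpha>|"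
      proof
        fix d assume "d \<in> C \<alpha>"
        then have d: "d < \<alpha>" using C_less[OF 3] by blast
        show "|(\<lambda>x. br (C \<alpha>) \<alpha> d x) ` T d| \<le>o |?K \<alpha>|"
          by (rule ordLeq_transitive[OF card_of_image ordLeq_transitive[OF less[OF d] mono[OF less_imp_le[OF d]]]])
      qed
    qed
    have Z: "|{zero_node \<alpha>}| \<le>o |?K \<alpha>|" by (simp add: card_of_singl_ordLeq)
    have "|?U \<union> {zero_node \<alpha>}| \<le>o |?K \<alpha>|"
      by (rule card_of_Un_ordLeq_infinite_Field[OF _ U Z card_of_Card_order]) (simp add: Field_card_of)
    moreover have "|T \<alpha>| \<le>o |?U \<union> {zero_node \<alpha>}|"
      by (rule card_of_mono1) (use T_limit[OF 3] in \<open>auto split: if_splits\<close>)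
    ultimately show ?thesis using ordLeq_transitive by blast
  qed
qed

lemma Tree_slim: "slim Tree"
  unfolding slim_def level_Tree
proof
  fix \<alpha> :: 'a
  show "|T \<alpha>| \<le>o |{..<\<alpha>}| \<or> countable (T \<alpha>)"
  proof (cases "finite {..<\<alpha>}")
    case True
    then have "countable ({..<\<alpha>} <+> (UNIV :: nat set))" by (simp add: countable_finite)
    moreover obtain g where "inj_on g (T \<alpha>)" "g ` T \<alpha> \<subseteq> {..<\<alpha>} <+> (UNIV :: nat set)"
      using T_card[of \<alpha>] by (auto simp: card_of_ordLeq[symmetric])
    ultimately show ?thesis by (meson countable_image_inj_on countable_subset)
  next
    case False
    then have "|UNIV :: nat set| \<le>o |{..<\<alpha>}|" by (simp add: infinite_iff_card_of_nat)
    then have "|{..<\<alpha>} <+> (UNIV :: nat set)| =o |{..<\<alpha>}|" using card_of_Plus_infinite[OF False] by blast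
    then show ?thesis using T_card[of \<alpha>] ordLeq_ordIso_trans by blast
  qed
qed

lemma Tree_ascent_path: "injective_fin_ascent_path Tree \<Theta> f"
  unfolding injective_fin_ascent_path_def level_Tree
proof (intro conjI allI ballI impI)
  show "f \<alpha> i \<in> T \<alpha>" if "i \<in> \<Theta>" for \<alpha> i using f_in_T[OF that] .
  obtain \<alpha> where "d0 < \<alpha>" using unbounded by blast
  then show "\<exists>\<alpha> I. I \<subseteq> \<Theta> \<and> finite (\<Theta> - I) \<and> inj_on (f \<alpha>) I"
    using f_inj by (intro exI[of _ \<alpha>] exI[of _ \<Theta>]) auto
  fix \<alpha> \<beta> :: 'a assume "\<alpha> < \<beta>"
  have "f \<alpha> i \<noteq> f \<beta> i" if "i \<in> \<Theta>" for i
    using T_unique[of "f \<alpha> i" \<alpha> \<beta>] f_in_T[OF that, of \<alpha>] f_in_T[OF that, of \<beta>] \<open>\<alpha> < \<beta>\<close> by auto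
  then have "\<Theta> - {i\<in>\<Theta>. ext_strict (f \<alpha> i) (f \<beta> i)} \<subseteq> {i\<in>\<Theta>. \<not> f \<alpha> i \<subseteq>\<^sub>m f \<beta> i}"
    by (auto simp: ext_strict_def)
  then show "finite (\<Theta> - {i\<in>\<Theta>. ext_strict (f \<alpha> i) (f \<beta> i)})"
    using f_ascent[OF \<open>\<alpha> < \<beta>\<close>] finite_subset by blast
qed

end

section \<open>Regular cardinals, closure points and coding by diamond\<close>

definition nodes :: "'a::wellorder node set" where
  "nodes = {x. \<exists>\<alpha>. dom x = {..<\<alpha>}}"

context
  assumes K: "kappa_regular_uncountable TYPE('a::wellorder)"
begin

lemma kappa_uncountable: "\<not> countable (UNIV :: 'a set)"
  and kappa_initial: "|{..<\<alpha>::'a}| <o |UNIV :: 'a set|"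
  and kappa_cofinal: "\<forall>\<alpha>::'a. \<exists>x\<in>X. \<alpha> \<le> x \<Longrightarrow> |X| =o |UNIV :: 'a set|"
  using K unfolding kappa_regular_uncountable_def by blast+

lemma kappa_infinite: "infinite (UNIV :: 'a set)"
  using kappa_uncountable countable_finite by blast

lemma small_set_bounded:
  fixes X :: "'a set"
  assumes "|X| <o |UNIV :: 'a set|"
  shows "\<exists>b. \<forall>x\<in>X. x < b"
proof (rule ccontr)
  assume "\<nexists>b. \<forall>x\<in>X. x < b"
  then have "\<forall>\<alpha>. \<exists>x\<in>X. \<alpha> \<le> x" by (meson not_le)
  then show False using kappa_cofinal assms not_ordLess_ordIso by blast
qed

lemma small_image_bounded:
  fixes g :: "'b \<Rightarrow> 'a"
  assumes "|X| <o |UNIV :: 'a set|"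
  shows "\<exists>b. \<forall>x\<in>X. g x < b"
proof -
  have "|g ` X| <o |UNIV :: 'a set|" using card_of_image assms by (rule ordLeq_ordLess_trans)
  from small_set_bounded[OF this] show ?thesis by blast
qed

lemma countable_small: "countable X \<Longrightarrow> |X| <o |UNIV :: 'a set|"
proof (rule ccontr)
  assume X: "countable X" and "\<not> |X| <o |UNIV :: 'a set|"
  then have "|UNIV :: 'a set| \<le>o |X|" by (simp add: not_ordLess_iff_ordLeq card_of_Well_order)
  then obtain g :: "'a \<Rightarrow> _" where "inj g" "range g \<subseteq> X" by (auto simp: card_of_ordLeq[symmetric])
  then show False using X kappa_uncountable by (meson countable_image_inj_on countable_subset)
qed

lemma kappa_unbounded: "\<exists>b. (a::'a) < b"
proof -
  have "|{a}| <o |UNIV :: 'a set|"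
    by (rule countable_small) simp
  from small_set_bounded[OF this] show ?thesis by blast
qed

lemma kappa_atMost: "|{..\<alpha>::'a}| <o |UNIV :: 'a set|"
proof -
  obtain b where "\<alpha> < b" using kappa_unbounded by blast
  then have "|{..\<alpha>}| \<le>o |{..<b}|" by (intro card_of_mono1) auto
  then show ?thesis using kappa_initial by (rule ordLeq_ordLess_trans)
qed

lemma club_closure_points:
  fixes g :: "'a \<Rightarrow> 'a"
  shows "club {\<beta>. (\<exists>\<gamma>. \<gamma> < \<beta>) \<and> (\<forall>\<gamma><\<beta>. g \<gamma> < \<beta>)}" (is "club ?D")
  unfolding club_def
proof (intro conjI allI impI)
  fix \<alpha> :: 'a
  have "\<exists>b. \<delta> < b \<and> (\<forall>\<gamma>\<le>\<delta>. g \<gamma> < b)" for \<delta>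
  proof -
    obtain b where b: "\<forall>x\<in>{..\<delta>}. g x < b" using small_image_bounded[OF kappa_atMost] by blast
    obtain b' where "max \<delta> b < b'" using kappa_unbounded by blast
    then show ?thesis using b by (intro exI[of _ b']) (auto intro: less_trans)
  qed
  \<comment> \<open>By regularity one jump \<open>G\<close> exceeds \<delta> and all values of
    \<open>g\<close> up to \<delta>. The supremum of its iterates is closed under \<open>g\<close>,
    and it exists since \<kappa> has uncountable cofinality.\<close>
  then obtain G where G: "\<And>\<delta>. \<delta> < G \<delta>" "\<And>\<delta> \<gamma>. \<gamma> \<le> \<delta> \<Longrightarrow> g \<gamma> < G \<delta>" by metis
  define s where "s n = (G ^^ n) \<alpha>" for n
  have s: "s (Suc n) = G (s n)" for n by (simp add: s_def)
  have ub: "\<exists>b. \<forall>n. s n < b"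
    using small_set_bounded[OF countable_small, of "range s"] by auto
  define \<beta> where "\<beta> = (LEAST b. \<forall>n. s n < b)"
  have \<beta>: "s n < \<beta>" for n unfolding \<beta>_def using LeastI_ex[OF ub] by blast
  have "\<alpha> < \<beta>" using \<beta>[of 0] by (simp add: s_def)
  moreover have "g \<gamma> < \<beta>" if "\<gamma> < \<beta>" for \<gamma>
  proof -
    have "\<not> (\<forall>n. s n < \<gamma>)" using not_less_Least[OF that[unfolded \<beta>_def]] .
    then obtain n where "\<gamma> \<le> s n" by (auto simp: not_less)
    then have "g \<gamma> < s (Suc n)" unfolding s by (rule G(2))
    then show ?thesis using \<beta> less_trans by blast
  qed
  ultimately show "\<exists>c\<in>?D. \<alpha> < c" by blast
next
  fix \<alpha> :: 'a assume acc: "acc_pt ?D \<alpha>"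
  have "g \<gamma> < \<alpha>" if "\<gamma> < \<alpha>" for \<gamma>
  proof -
    obtain x where "x \<in> ?D \<inter> {..<\<alpha>}" "\<gamma> < x"
      using acc \<open>\<gamma> < \<alpha>\<close> unfolding acc_pt_def sup_eq_def by blast
    then have "g \<gamma> < x" "x < \<alpha>" by simp_all
    then show ?thesis by (rule less_trans)
  qed
  then show "\<alpha> \<in> ?D" using acc by (auto simp: acc_pt_def)
qed

text \<open>Closing under \<open>max b (g \<gamma>)\<close> rather than \<open>g \<gamma>\<close>
  also places the point above \<open>b\<close>.\<close>

lemma stationary_closure_point:
  fixes g :: "'a \<Rightarrow> 'a"
  assumes "stationary S"
  shows "\<exists>\<alpha>\<in>S. b < \<alpha> \<and> (\<forall>\<gamma><\<alpha>. g \<gamma> < \<alpha>)"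
proof -
  have "S \<inter> {\<beta>. (\<exists>\<gamma>. \<gamma> < \<beta>) \<and> (\<forall>\<gamma><\<beta>. max b (g \<gamma>) < \<beta>)} \<noteq> {}"
    using assms club_closure_points[of "\<lambda>\<gamma>. max b (g \<gamma>)"] unfolding stationary_def by simp
  then obtain \<alpha> \<gamma> where \<alpha>: "\<alpha> \<in> S" "\<gamma> < \<alpha>" "\<And>\<gamma>. \<gamma> < \<alpha> \<Longrightarrow> max b (g \<gamma>) < \<alpha>" by blast
  then have "b < \<alpha>" "\<And>\<gamma>. \<gamma> < \<alpha> \<Longrightarrow> g \<gamma> < \<alpha>" using \<alpha>(3)[of \<gamma>] by auto
  then show ?thesis using \<alpha>(1) by blast
qed

text \<open>Diamond yields \<kappa>^{<\<kappa>} = \<kappa>: the image of a small set in \<kappa> is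
  bounded, hence guessed in full at some stage above its bound, and that stage determines the
  set.\<close>

lemma card_small_subsets:
  assumes "diamond TYPE('a)" "|B| \<le>o |UNIV :: 'a set|"
  shows "|{Z. Z \<subseteq> B \<and> |Z| <o |UNIV :: 'a set| }| \<le>o |UNIV :: 'a set|" (is "|?Q| \<le>o _")
proof -
  obtain A :: "'a \<Rightarrow> 'a set" where A: "\<And>Z. stationary {\<alpha>. Z \<inter> {..<\<alpha>} = A \<alpha>}"
    using assms(1) by (auto simp: diamond_def)
  obtain k :: "_ \<Rightarrow> 'a" where k: "inj_on k B" using assms(2) by (auto simp: card_of_ordLeq[symmetric])
  have "\<exists>\<alpha>. k ` Z = A \<alpha>" if Z: "Z \<in> ?Q" for Z
  proof -
    obtain b where b: "\<forall>x\<in>Z. k x < b" using small_image_bounded[of Z k] Z by auto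
    have "\<exists>\<alpha>\<in>{\<alpha>. k ` Z \<inter> {..<\<alpha>} = A \<alpha>}. b < \<alpha> \<and> (\<forall>\<gamma><\<alpha>. \<gamma> < \<alpha>)"
      by (rule stationary_closure_point[OF A])
    then obtain \<alpha> where \<alpha>: "b < \<alpha>" "k ` Z \<inter> {..<\<alpha>} = A \<alpha>" by auto
    then have "k ` Z \<inter> {..<\<alpha>} = k ` Z" using b by (auto intro: less_trans)
    then show ?thesis using \<alpha> by auto
  qed
  then have "\<forall>Z\<in>?Q. \<exists>\<alpha>. k ` Z = A \<alpha>" by blast
  from bchoice[OF this] obtain c where c: "\<forall>Z\<in>?Q. k ` Z = A (c Z)" by blast
  have "inj_on c ?Q"
  proof (rule inj_onI)
    fix Y Z assume YZ: "Y \<in> ?Q" "Z \<in> ?Q" "c Y = c Z"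
    then have "k ` Y = k ` Z" using bspec[OF c] by simp
    then show "Y = Z" using inj_on_image_eq_iff[OF k, of Y Z] YZ by simp
  qed
  then show ?thesis by (rule card_of_ordLeqI) simp
qed

text \<open>A pair \<open>(I, s)\<close> is recovered from the graph of \<open>s\<close> on
  \<open>I\<close>, as \<open>s\<close> is undefined elsewhere; the graphs are small sets.\<close>

lemma card_small_functions:
  assumes "diamond TYPE('a)" "|F| \<le>o |UNIV :: 'a set|" "|N| \<le>o |UNIV :: 'a set|"
  shows "|{(I, s). I \<subseteq> F \<and> |I| <o |UNIV :: 'a set| \<and> s \<in> Func I N}| \<le>o |UNIV :: 'a set|" (is "|?Q| \<le>o _")
proof -
  let ?G = "\<lambda>(I, s). (\<lambda>\<iota>. (\<iota>, s \<iota>)) ` I"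
  have FN: "|F \<times> N| \<le>o |UNIV :: 'a set|"
    using card_of_Times_ordLeq_infinite_Field[OF _ assms(2,3) card_of_Card_order] kappa_infinite
    by (simp add: Field_card_of)
  have "inj_on ?G ?Q"
  proof (rule inj_onI, clarify)
    fix I s J t
    assume s: "s \<in> Func I N" and t: "t \<in> Func J N" and eq: "(\<lambda>\<iota>. (\<iota>, s \<iota>)) ` I = (\<lambda>\<iota>. (\<iota>, t \<iota>)) ` J"
    have "I = J" using arg_cong[OF eq, of "\<lambda>X. fst ` X"] by (simp add: image_image)
    moreover have "s \<iota> = t \<iota>" for \<iota>
      using eq s t \<open>I = J\<close> by (cases "\<iota> \<in> I") (auto simp: Func_def)
    ultimately show "I = J \<and> s = t" by blast
  qed
  moreover have "?G ` ?Q \<subseteq> {Z. Z \<subseteq> F \<times> N \<and> |Z| <o |UNIV :: 'a set| }"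
  proof (clarify, intro conjI)
    fix I s assume *: "I \<subseteq> F" "|I| <o |UNIV :: 'a set|" "s \<in> Func I N"
    show "|(\<lambda>\<iota>. (\<iota>, s \<iota>)) ` I| <o |UNIV :: 'a set|"
      using card_of_image *(2) by (rule ordLeq_ordLess_trans)
    show "(\<lambda>\<iota>. (\<iota>, s \<iota>)) ` I \<subseteq> F \<times> N" using * by (auto simp: Func_def)
  qed
  ultimately have "|?Q| \<le>o |{Z. Z \<subseteq> F \<times> N \<and> |Z| <o |UNIV :: 'a set| }|" 
    by (meson card_of_ordLeq)
  then show ?thesis using card_small_subsets[OF assms(1) FN] by (rule ordLeq_transitive)
qed

lemma card_nodes:
  assumes "diamond TYPE('a)"
  shows "|nodes :: 'a node set| \<le>o |UNIV :: 'a set|"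
proof -
  let ?G = "\<lambda>x :: 'a node. {(a, b). x a = Some b}"
  have UU: "|UNIV :: ('a \<times> 'a) set| \<le>o |UNIV :: 'a set|"
    using card_of_Times_same_infinite[OF kappa_infinite] by (simp add: ordIso_imp_ordLeq)
  have "|nodes :: 'a node set| \<le>o |{Z :: ('a \<times> 'a) set. Z \<subseteq> UNIV \<and> |Z| <o |UNIV :: 'a set| }|"
  proof (rule card_of_ordLeqI[of ?G])
    show "inj_on ?G nodes"
    proof (rule inj_onI, rule ext)
      fix x y :: "'a node" and a assume "?G x = ?G y"
      then have "x a = Some b \<longleftrightarrow> y a = Some b" for b by blast
      then show "x a = y a" by (metis not_Some_eq)
    qed
    fix x :: "'a node" assume "x \<in> nodes"
    then obtain \<alpha> where \<alpha>: "dom x = {..<\<alpha>}" by (auto simp: nodes_def)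
    have "?G x = (\<lambda>a. (a, the (x a))) ` {..<\<alpha>}" unfolding \<alpha>[symmetric] by force
    then have "|?G x| <o |UNIV :: 'a set|"
      using ordLeq_ordLess_trans[OF card_of_image kappa_initial] by metis
    then show "?G x \<in> {Z. Z \<subseteq> UNIV \<and> |Z| <o |UNIV :: 'a set| }" by simp
  qed
  then show ?thesis using card_small_subsets[OF assms UU] by (rule ordLeq_transitive)
qed

text \<open>The hypothesis \<open>small_below\<close> speaks of initial segments only. The index set
  is transported to a proper segment of \<chi>, and the small set \<open>A\<close> into a segment of
  \<kappa> by regularity.\<close>

lemma small_Func:
  fixes A :: "'b set" and \<chi> :: "'c rel"
  assumes small: "small_below TYPE('a) \<chi>" and \<chi>: "Card_order \<chi>" and I: "|I| <o \<chi>"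
    and A: "|A| <o |UNIV :: 'a set|"
  shows "|Func I A| <o |UNIV :: 'a set|"
proof -
  obtain k :: "'b \<Rightarrow> 'a" where k: "inj_on k A"
    using ordLess_imp_ordLeq[OF A] by (auto simp: card_of_ordLeq[symmetric])
  obtain l where l: "\<forall>x\<in>A. k x < l" using small_image_bounded[OF A] by blast
  have wo: "Well_order \<chi>" using \<chi> by (simp add: card_order_on_well_order_on)
  obtain c where c: "c \<in> Field \<chi>" "|I| =o Restr \<chi> (underS \<chi> c)"
    using I ordLess_iff_ordIso_Restr[OF wo card_of_Well_order] by blast
  have "Field (Restr \<chi> (underS \<chi> c)) = underS \<chi> c"
    using Refl_Field_Restr[of \<chi> "underS \<chi> c"] wo underS_Field
    by (auto simp: order_on_defs)
  then have "|I| =o |underS \<chi> c|" using card_of_cong[OF c(2)] by (simp add: Field_card_of)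
  then obtain e where e: "bij_betw e (underS \<chi> c) I"
    using card_of_ordIso ordIso_symmetric by blast
  let ?G = "\<lambda>s a. if a \<in> underS \<chi> c then k (s (e a)) else undefined"
  have "|Func I A| \<le>o |Func (underS \<chi> c) {..<l}|"
  proof (rule card_of_ordLeqI[of ?G])
    show "inj_on ?G (Func I A)"
    proof (rule inj_onI, rule ext)
      fix s t \<iota> assume st: "s \<in> Func I A" "t \<in> Func I A" "?G s = ?G t"
      show "s \<iota> = t \<iota>"
      proof (cases "\<iota> \<in> I")
        case True
        then obtain a where a: "a \<in> underS \<chi> c" "e a = \<iota>" using e by (auto simp: bij_betw_def)
        then have "k (s \<iota>) = k (t \<iota>)" using fun_cong[OF st(3), of a] by simp
        then show ?thesis using k st True by (auto simp: Func_def dest: inj_onD)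
      qed (use st in \<open>auto simp: Func_def\<close>)
    qed
    fix s assume "s \<in> Func I A"
    then show "?G s \<in> Func (underS \<chi> c) {..<l}"
      using e l by (auto simp: Func_def bij_betw_def)
  qed
  moreover obtain \<nu> where "|Func (underS \<chi> c) {..<l}| \<le>o |{..<\<nu>::'a}|"
    using small c(1) unfolding small_below_def by blast
  ultimately show ?thesis using kappa_initial by (meson ordLeq_ordLess_trans ordLeq_transitive)
qed

end

text \<open>Zero and successors have cofinal subsets with at most one element, whereas \<chi> is
  infinite.\<close>

lemma E_ge_limit:
  assumes "Card_order \<chi>" "infinite (Field \<chi>)" "\<alpha> \<in> E_ge \<chi>"
  shows "is_limit \<alpha>"
proof -
  have inf: "infinite X" if "X \<subseteq> {..<\<alpha>}" "\<forall>\<beta><\<alpha>. \<exists>x\<in>X. \<beta> \<le> x" for X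
  proof -
    have "\<chi> \<le>o |X|" using assms(3) that by (auto simp: E_ge_def)
    then have "|Field \<chi>| \<le>o |X|" using assms(1) card_of_Field_ordIso ordIso_ordLeq_trans by blast
    then show ?thesis using assms(2) card_of_ordLeq_infinite by blast
  qed
  show ?thesis
  proof (cases rule: zero_succ_limit[of \<alpha>])
    case 1
    then show ?thesis using inf[of "{}"] by auto
  next
    case (2 p)
    then show ?thesis using inf[of "{p}"] by (auto simp: is_pred_def)
  qed
qed

section \<open>Freeness and the Souslin property\<close>

definition families :: "'c rel \<Rightarrow> ('c set \<times> ('c \<Rightarrow> 'a::wellorder node)) set" where
  "families \<chi> = {(I, s). I \<subseteq> Field \<chi> \<and> |I| <o \<chi> \<and> s \<in> Func I nodes}"

text \<open>A code tagged \<open>True\<close> is the head of a guess and names a family; codes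
  tagged \<open>False\<close> name elements of the set to be sealed. A stage is constrained by
  \<open>decode\<close> only if its guess has exactly one head.\<close>

locale guided_construction = tree_construction C Ix sq Om d0 \<Theta> h
  for C :: "'a::wellorder \<Rightarrow> 'a set" and Ix :: "'a \<Rightarrow> 'c set" and sq Om d0
    and \<Theta> :: "'d set" and h +
  fixes \<chi> :: "'c rel" and A :: "'a \<Rightarrow> 'a set"
    and code :: "bool \<times> 'c set \<times> ('c \<Rightarrow> 'a node) \<Rightarrow> 'a"
  assumes kappa: "kappa_regular_uncountable TYPE('a)"
    and card_\<chi>: "Card_order \<chi>" and inf_\<chi>: "infinite (Field \<chi>)"
    and small: "small_below TYPE('a) \<chi>"
    and inf_\<Theta>: "infinite \<Theta>"
    and guess: "stationary {\<alpha>. Z \<inter> {..<\<alpha>} = A \<alpha>}"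
    and hits: "(\<And>i \<beta>. \<exists>a\<in>B i. \<beta> < a) \<Longrightarrow>
      stationary {\<alpha>\<in>E_ge \<chi>. \<forall>i<\<alpha>. sup_eq {\<beta>\<in>C \<alpha>. succ_omega (C \<alpha> - {..<\<beta>}) \<subseteq> B i} \<alpha>}"
    and inj_code: "inj_on code (UNIV \<times> families \<chi>)"
    and decode: "{w \<in> families \<chi>. code (True, w) \<in> A \<beta>} = {(I, s)} \<Longrightarrow>
      Ix \<beta> = I \<and> sq \<beta> = s \<and> Om \<beta> = {z. (I, z) \<in> families \<chi> \<and> code (False, I, z) \<in> A \<beta>}"
begin

section \<open>Small levels, decoding of guesses and walks with a common start\<close>

lemma T_small: "|T \<alpha>| <o |UNIV :: 'a set|"
proof -
  have "|{..<\<alpha>} <+> (UNIV :: nat set)| <o |UNIV :: 'a set|"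
    by (rule card_of_Plus_ordLess_infinite[OF kappa_infinite[OF kappa] kappa_initial[OF kappa] countable_small[OF kappa]]) simp
  then show ?thesis using T_card ordLeq_ordLess_trans by blast
qed

lemma T_nodes: "T \<alpha> \<subseteq> nodes"
  using T_dom by (auto simp: nodes_def)

lemma T_restrict_le: "x \<in> T \<beta> \<Longrightarrow> \<alpha> \<le> \<beta> \<Longrightarrow> x |` {..<\<alpha>} \<in> T \<alpha>"
  using T_restrict[of x \<beta> \<alpha>] T_dom[of x \<beta>] map_le_restrict_dom[of x x]
  by (cases "\<alpha> = \<beta>") auto

text \<open>Here \<lambda>^{<\<chi>} < \<kappa> enters: a level carries fewer than \<kappa>
  families, so codes and heights attached to them are bounded and closure points exist.\<close>

lemma families_bounded:
  assumes "I \<subseteq> Field \<chi>" "|I| <o \<chi>"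
  shows "\<exists>b. \<forall>s\<in>Func I (T p). g s < (b::'a)"
  by (rule small_image_bounded[OF kappa small_Func[OF kappa small card_\<chi> assms(2) T_small]])

lemma code_eq_iff:
  "w \<in> families \<chi> \<Longrightarrow> w' \<in> families \<chi> \<Longrightarrow> code (b, w) = code (b', w') \<longleftrightarrow> b = b' \<and> w = w'"
  using inj_code by (auto dest: inj_onD)

text \<open>Injectivity and tags of the codes leave a single head in the guess. Cutting at \<beta>
  loses exactly the members of \<open>F\<close> whose code is at least \<beta>.\<close>

lemma decode_guess:
  assumes Is: "(I, s) \<in> families \<chi>" and F: "\<And>z. z \<in> F \<Longrightarrow> (I, z) \<in> families \<chi>"
    and A: "insert (code (True, I, s)) ((\<lambda>z. code (False, I, z)) ` F) \<inter> {..<\<beta>} = A \<beta>"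
    and less: "code (True, I, s) < \<beta>"
  shows "Ix \<beta> = I" "sq \<beta> = s" "Om \<beta> = {z\<in>F. code (False, I, z) < \<beta>}"
proof -
  have "{w \<in> families \<chi>. code (True, w) \<in> A \<beta>} = {(I, s)}"
    unfolding A[symmetric] using Is F less by (auto simp: code_eq_iff)
  from decode[OF this] have 1: "Ix \<beta> = I" "sq \<beta> = s"
    "Om \<beta> = {z. (I, z) \<in> families \<chi> \<and> code (False, I, z) \<in> A \<beta>}" by auto
  have "{z. (I, z) \<in> families \<chi> \<and> code (False, I, z) \<in> A \<beta>} = {z\<in>F. code (False, I, z) < \<beta>}"
    unfolding A[symmetric] using Is F by (auto simp: code_eq_iff)
  then show "Ix \<beta> = I" "sq \<beta> = s" "Om \<beta> = {z\<in>F. code (False, I, z) < \<beta>}" using 1 by auto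
qed

text \<open>The ladder point following \<open>p\<close> is the first element of
  \<open>succ_omega (C \<alpha> - {..<p})\<close>.\<close>

lemma next_hit:
  assumes lim: "is_limit \<alpha>" and p: "p \<in> C \<alpha>" "succ_omega (C \<alpha> - {..<p}) \<subseteq> B"
  obtains \<beta> where "\<beta> \<in> C \<alpha>" "is_pred (C \<alpha>) \<beta> p" "\<beta> \<in> B"
proof -
  define \<beta> where "\<beta> = (LEAST \<beta>. \<beta> \<in> C \<alpha> \<and> p < \<beta>)"
  have "\<exists>\<beta>. \<beta> \<in> C \<alpha> \<and> p < \<beta>" using C_unbounded[OF lim C_less[OF lim p(1)]] by blast
  then have \<beta>: "\<beta> \<in> C \<alpha> \<and> p < \<beta>" unfolding \<beta>_def by (rule LeastI_ex)
  have least: "\<beta> \<le> c" if "c \<in> C \<alpha>" "p < c" for c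
    unfolding \<beta>_def using that by (intro Least_le) blast
  have eq: "(C \<alpha> - {..<p}) \<inter> {..<\<beta>} = {p}"
    using p(1) \<beta> least by (force simp: not_less)
  have "\<beta> \<in> succ_omega (C \<alpha> - {..<p})"
    unfolding succ_omega_def mem_Collect_eq eq using \<beta> by auto
  moreover have "is_pred (C \<alpha>) \<beta> p"
    using p(1) \<beta> least by (force simp: is_pred_def)
  ultimately show ?thesis using that \<beta> p(2) by blast
qed

text \<open>Above \<open>d0\<close> every node of a limit level is the limit of a walk. Fewer than
  \<chi> starts are bounded below \<alpha> because of its cofinality, and \<open>br_compose\<close>
  moves them all to one later ladder level.\<close>

lemma common_start:
  assumes \<alpha>: "\<alpha> \<in> E_ge \<chi>" "d0 < \<alpha>" and I: "|I| <o \<chi>" and y: "\<And>\<iota>. \<iota> \<in> I \<Longrightarrow> y \<iota> \<in> T \<alpha>" and b: "b < \<alpha>"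
  shows "\<exists>\<delta>\<in>C \<alpha>. \<exists>s\<in>Func I (T \<delta>). b < \<delta> \<and> (\<forall>\<iota>\<in>I. y \<iota> = br (C \<alpha>) \<alpha> \<delta> (s \<iota>))"
proof -
  have lim: "is_limit \<alpha>" by (rule E_ge_limit[OF card_\<chi> inf_\<chi> \<alpha>(1)])
  have "\<exists>d x. d \<in> C \<alpha> \<and> x \<in> T d \<and> y \<iota> = br (C \<alpha>) \<alpha> d x" if "\<iota> \<in> I" for \<iota>
    using y[OF that] \<alpha>(2) unfolding T_limit[OF lim] by (auto split: if_splits)
  then obtain d x where dx: "\<And>\<iota>. \<iota> \<in> I \<Longrightarrow> d \<iota> \<in> C \<alpha> \<and> x \<iota> \<in> T (d \<iota>) \<and> y \<iota> = br (C \<alpha>) \<alpha> (d \<iota>) (x \<iota>)"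
    by metis
  have "|d ` I| <o \<chi>" using card_of_image I by (rule ordLeq_ordLess_trans)
  then have "\<not> \<chi> \<le>o |d ` I|" using not_ordLess_ordLeq by blast
  moreover have "d ` I \<subseteq> {..<\<alpha>}" using dx C_less[OF lim] by auto
  ultimately have "\<not> (\<forall>\<beta><\<alpha>. \<exists>x\<in>d ` I. \<beta> \<le> x)"
    using \<alpha>(1) unfolding E_ge_def by blast
  then obtain e where e: "e < \<alpha>" "\<forall>\<iota>\<in>I. d \<iota> < e" by (auto simp: not_le)
  obtain \<delta> where \<delta>: "\<delta> \<in> C \<alpha>" "max e b < \<delta>" using C_unbounded[OF lim, of "max e b"] e b by auto
  have d\<delta>: "d \<iota> \<le> \<delta>" if "\<iota> \<in> I" for \<iota> using e(2) \<delta>(2) that by (meson less_imp_le less_trans max_less_iff_conj)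
  define s where "s \<iota> = (if \<iota> \<in> I then br (C \<alpha>) \<delta> (d \<iota>) (x \<iota>) else undefined)" for \<iota>
  show ?thesis
  proof (intro bexI[of _ s] bexI[OF _ \<delta>(1)] conjI ballI)
    show "b < \<delta>" using \<delta>(2) by simp
    show "s \<in> Func I (T \<delta>)"
      using br_in_T[OF lim] dx \<delta>(1) d\<delta> by (auto simp: Func_def s_def)
    show "y \<iota> = br (C \<alpha>) \<alpha> \<delta> (s \<iota>)" if "\<iota> \<in> I" for \<iota>
      using br_compose[OF lim _ _ \<delta>(1) d\<delta>[OF that], of "x \<iota>" \<alpha>] dx[OF that] that C_less[OF lim \<delta>(1)]
      by (simp add: s_def)
  qed
qed

text \<open>An index that is not relevant sits on a path node at level \<open>p\<close>. Different
  indices have different positions, and the unique path start provides at most |\<Theta>| path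
  nodes.\<close>

lemma card_not_relevant:
  assumes lim: "is_limit \<alpha>" and p: "p \<in> C \<alpha>" and d: "d \<in> C \<alpha>" "d \<le> p"
    and Ix: "Ix \<beta> = I" "sq \<beta> = s" and s: "\<And>\<iota>. \<iota> \<in> I \<Longrightarrow> s \<iota> \<in> T d" "inj_on s I"
  shows "|I - relevant \<beta> (path_nodes f (C \<alpha>) p (br (C \<alpha>) p)) (br (C \<alpha>) p) d| \<le>o |\<Theta>|"
    (is "|I - ?R| \<le>o _")
proof -
  let ?P = "path_nodes f (C \<alpha>) p (br (C \<alpha>) p)"
  have "inj_on (\<lambda>\<iota>. br (C \<alpha>) p d (s \<iota>)) (I - ?R)"
  proof (rule inj_onI)
    fix \<iota> \<kappa> assume *: "\<iota> \<in> I - ?R" "\<kappa> \<in> I - ?R" "br (C \<alpha>) p d (s \<iota>) = br (C \<alpha>) p d (s \<kappa>)"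
    then have "s \<iota> = s \<kappa>" using br_inj[OF lim d(1) s(1) s(1) _ d(2)] p by blast
    then show "\<iota> = \<kappa>" using s(2) * by (auto dest: inj_onD)
  qed
  moreover have "br (C \<alpha>) p d (s \<iota>) \<in> ?P" if "\<iota> \<in> I - ?R" for \<iota>
    using that Ix by (auto simp: relevant_def)
  ultimately have "|I - ?R| \<le>o |?P|" by (rule card_of_ordLeqI)
  moreover have "|?P| \<le>o |\<Theta>|"
  proof (cases "\<exists>c. path_start (C \<alpha>) c")
    case True
    then obtain c where c: "path_start (C \<alpha>) c" by blast
    then have "?P \<subseteq> (\<lambda>i. br (C \<alpha>) p c (f c i)) ` \<Theta>"
      unfolding path_nodes_def using path_start_unique by blast
    then show ?thesis by (rule ordLeq_transitive[OF card_of_mono1 card_of_image])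
  next
    case False
    then have "?P = {}" by (auto simp: path_nodes_def)
    then show ?thesis by (simp add: card_of_empty)
  qed
  ultimately show ?thesis by (rule ordLeq_transitive)
qed

text \<open>By regularity the codes of all families on levels below \<alpha> have a common bound, so
  fewer than \<kappa> members of \<open>F\<close> can have height below \<alpha>.\<close>

lemma many_heights:
  assumes I: "I \<subseteq> Field \<chi>" "|I| <o \<chi>"
    and F: "|F| =o |UNIV :: 'a set|" "F \<subseteq> Func I UNIV" "\<And>z \<iota>. z \<in> F \<Longrightarrow> \<iota> \<in> I \<Longrightarrow> z \<iota> \<in> T (ht z)"
  shows "\<exists>y\<in>F. \<alpha> \<le> ht y"
proof (rule ccontr)
  assume "\<not> (\<exists>y\<in>F. \<alpha> \<le> ht y)"
  then have ht: "z \<in> F \<Longrightarrow> ht z < \<alpha>" for z by (auto simp: not_le)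
  have fam: "(I, z) \<in> families \<chi>" if "z \<in> F" for z
    using that I F T_nodes by (fastforce simp: families_def Func_def)
  obtain g where g: "\<And>p s. s \<in> Func I (T p) \<Longrightarrow> code (False, I, s) < g p"
    using families_bounded[OF I, of _ "\<lambda>s. code (False, I, s)"] by metis
  obtain b where b: "\<forall>p\<in>{..<\<alpha>}. g p < b" using small_image_bounded[OF kappa kappa_initial[OF kappa]] by blast
  have "|F| \<le>o |{..<b}|"
  proof (rule card_of_ordLeqI[of "\<lambda>z. code (False, I, z)"])
    show "inj_on (\<lambda>z. code (False, I, z)) F"
      by (rule inj_onI) (use fam code_eq_iff in blast)
    fix z assume z: "z \<in> F"
    then have "z \<in> Func I (T (ht z))" using F by (auto simp: Func_def)
    then show "code (False, I, z) \<in> {..<b}" using g b ht[OF z] by (auto intro: less_trans)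
  qed
  then have "|F| <o |UNIV :: 'a set|" using kappa_initial[OF kappa] by (rule ordLeq_ordLess_trans)
  then show False using F(1) not_ordLess_ordIso by blast
qed

text \<open>The common source of freeness and of the bound on antichains; the clause for finite
  \<open>I\<close> serves the latter. The element \<open>y\<close> reaches at least level \<alpha>,
  while \<open>x\<close> lies below a ladder point of \<alpha> at which the walks towards
  \<open>y\<close> were steered above it.\<close>

theorem sealed_pair:
  assumes I: "I \<subseteq> Field \<chi>" "I \<noteq> {}" "|I| <o \<chi>"
    and w: "\<And>\<iota>. \<iota> \<in> I \<Longrightarrow> w \<iota> \<in> T \<beta>0" "inj_on w I"
    and F: "F \<subseteq> derived_tree Tree I w" "|F| =o |UNIV :: 'a set|"
  shows "\<exists>x\<in>F. \<exists>y\<in>F. \<exists>R\<subseteq>I. (\<forall>\<iota>\<in>R. ext_strict (x \<iota>) (y \<iota>)) \<and> |I - R| \<le>o |\<Theta>| \<and> (finite I \<longrightarrow> R = I)"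
proof -
  have FF: "F \<subseteq> Func I UNIV" using F by (auto simp: derived_tree_def Func_def)
  have "\<exists>\<alpha>. \<forall>\<iota>\<in>I. z \<iota> \<in> T \<alpha>" if z: "z \<in> F" for z
  proof -
    have zD: "z \<in> derived_tree Tree I w" using z F by blast
    then obtain \<alpha> where "\<forall>\<iota>\<in>I. dom (z \<iota>) = {..<\<alpha>}" unfolding derived_tree_def by blast
    moreover have "\<forall>\<iota>\<in>I. z \<iota> \<in> Tree" using zD by (simp add: derived_tree_def Func_def)
    ultimately have "\<forall>\<iota>\<in>I. dom (z \<iota>) = {..<\<alpha>} \<and> z \<iota> \<in> Tree" by blast
    then have "\<forall>\<iota>\<in>I. z \<iota> \<in> level Tree \<alpha>" by (simp add: level_def)
    then show ?thesis unfolding level_Tree by blast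
  qed
  then obtain ht where ht: "\<And>z \<iota>. z \<in> F \<Longrightarrow> \<iota> \<in> I \<Longrightarrow> z \<iota> \<in> T (ht z)" by metis
  have compat: "compat (z \<iota>) (w \<iota>)" if "z \<in> F" "\<iota> \<in> I" for z \<iota>
    using that F by (auto simp: derived_tree_def)
  have fam: "(I, z) \<in> families \<chi>" if "z \<in> Func I (T p)" for z p
    using that I T_nodes by (fastforce simp: families_def Func_def)
  have Ffam: "(I, z) \<in> families \<chi>" if "z \<in> F" for z
  proof (rule fam)
    show "z \<in> Func I (T (ht z))" using that ht FF by (auto simp: Func_def)
  qed

  text \<open>If some member of \<open>F\<close> lies above a family \<open>u\<close> on level \<open>p\<close>, then one with code and height below
    \<open>g p\<close> does; hence at a closure point of \<open>g\<close> the guess \<open>Om\<close> contains such a member.\<close>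
  define above where "above u z \<longleftrightarrow> z \<in> F \<and> (\<forall>\<iota>\<in>I. u \<iota> \<subseteq>\<^sub>m z \<iota>)" for u z
  define pick where "pick u = (SOME z. above u z)" for u
  have pick: "above u (pick u)" if "above u z" for u z
    unfolding pick_def by (rule someI[of "above u", OF that])
  obtain g where g: "\<And>p u. u \<in> Func I (T p) \<Longrightarrow> max (code (False, I, pick u)) (ht (pick u)) < g p"
    using families_bounded[OF I(1,3), of _ "\<lambda>u. max (code (False, I, pick u)) (ht (pick u))"] by metis
  obtain k where k: "\<And>p s. s \<in> Func I (T p) \<Longrightarrow> code (True, I, s) < k p"
    using families_bounded[OF I(1,3), of _ "\<lambda>s. code (True, I, s)"] by metis

  \<comment> \<open>The head \<open>i\<close> stays a parameter, and all heads are guessed at once,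
    because the family \<open>s\<close> is found only after \<alpha> has been chosen.\<close>
  define B where "B i = {\<beta>. insert i ((\<lambda>z. code (False, I, z)) ` F) \<inter> {..<\<beta>} = A \<beta> \<and> i < \<beta> \<and> (\<forall>p<\<beta>. g p < \<beta>)}" for i
  have "\<exists>\<beta>\<in>B i. b < \<beta>" for i b
    using stationary_closure_point[OF kappa guess[of "insert i ((\<lambda>z. code (False, I, z)) ` F)"], of "max b i" g]
    by (auto simp: B_def)
  \<comment> \<open>Closure under \<open>k\<close> puts the head of any family on a level below
    \<alpha> below \<alpha> itself, hence among the indices hit at \<alpha>.\<close>
  from stationary_closure_point[OF kappa hits[of B, OF this], of "max d0 \<beta>0" k]
  obtain \<alpha> where \<alpha>: "\<alpha> \<in> E_ge \<chi>" "d0 < \<alpha>" "\<beta>0 < \<alpha>" "\<And>p. p < \<alpha> \<Longrightarrow> k p < \<alpha>"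
    and hit: "\<And>i. i < \<alpha> \<Longrightarrow> sup_eq {\<beta>\<in>C \<alpha>. succ_omega (C \<alpha> - {..<\<beta>}) \<subseteq> B i} \<alpha>"
    by auto
  have lim: "is_limit \<alpha>" by (rule E_ge_limit[OF card_\<chi> inf_\<chi> \<alpha>(1)])

  obtain y where y: "y \<in> F" "\<alpha> \<le> ht y" using many_heights[OF I(1,3) F(2) FF ht] by blast
  define y' where "y' \<iota> = y \<iota> |` {..<\<alpha>}" for \<iota>
  have y'T: "y' \<iota> \<in> T \<alpha>" if "\<iota> \<in> I" for \<iota>
    unfolding y'_def by (rule T_restrict_le[OF ht[OF y(1) that] y(2)])
  have y'y: "y' \<iota> \<subseteq>\<^sub>m y \<iota>" for \<iota> unfolding y'_def by (rule restrict_map_le)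
  obtain \<delta> s where \<delta>: "\<delta> \<in> C \<alpha>" "\<beta>0 < \<delta>" and s: "s \<in> Func I (T \<delta>)"
    and "\<forall>\<iota>\<in>I. y' \<iota> = br (C \<alpha>) \<alpha> \<delta> (s \<iota>)"
    using common_start[where y = y', OF \<alpha>(1,2) I(3) y'T \<alpha>(3)] by blast
  then have y's: "\<And>\<iota>. \<iota> \<in> I \<Longrightarrow> y' \<iota> = br (C \<alpha>) \<alpha> \<delta> (s \<iota>)" by blast
  have sT: "s \<iota> \<in> T \<delta>" if "\<iota> \<in> I" for \<iota> using s that by (auto simp: Func_def)
  have \<delta>\<alpha>: "\<delta> < \<alpha>" by (rule C_less[OF lim \<delta>(1)])
  have sy: "s \<iota> \<subseteq>\<^sub>m y \<iota>" if "\<iota> \<in> I" for \<iota>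
    using br_extends[OF lim \<delta>(1) sT[OF that], of \<alpha>] \<delta>\<alpha> y'y[of \<iota>] y's[OF that] map_le_trans by force
  \<comment> \<open>As \<open>y\<close> is higher than level \<beta>0, compatibility means that it
    extends \<open>w\<close>; both \<open>w\<close> and \<open>s\<close> are then initial parts of
    \<open>y\<close>.\<close>
  have ws: "w \<iota> \<subseteq>\<^sub>m s \<iota>" if "\<iota> \<in> I" for \<iota>
  proof (rule map_le_common[OF _ sy[OF that]])
    have dom: "dom (w \<iota>) = {..<\<beta>0}" "dom (y \<iota>) = {..<ht y}" "dom (s \<iota>) = {..<\<delta>}"
      using T_dom w(1) ht[OF y(1)] sT that by blast+
    have "\<beta>0 < ht y" using \<alpha>(3) y(2) by simp
    then have "\<not> dom (y \<iota>) \<subseteq> dom (w \<iota>)" unfolding dom by auto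
    then show "w \<iota> \<subseteq>\<^sub>m y \<iota>"
      using compat[OF y(1) that] map_le_implies_dom_le unfolding compat_def by blast
    show "dom (w \<iota>) \<subseteq> dom (s \<iota>)" unfolding dom using \<delta>(2) by auto
  qed
  have inj_s: "inj_on s I"
  proof (rule inj_onI)
    fix \<iota> \<kappa> assume *: "\<iota> \<in> I" "\<kappa> \<in> I" "s \<iota> = s \<kappa>"
    then have "w \<iota> = w \<kappa>"
      using T_eqI[OF w(1) w(1), of \<iota> \<kappa> "s \<iota>"] ws[OF *(1)] ws[OF *(2)] by simp
    then show "\<iota> = \<kappa>" using w(2) * by (auto dest: inj_onD)
  qed

  define i where "i = code (True, I, s)"
  have "i < \<alpha>" unfolding i_def using k[OF s] \<alpha>(4)[OF \<delta>\<alpha>] by (rule less_trans)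
  then obtain p where p: "p \<in> C \<alpha>" "succ_omega (C \<alpha> - {..<p}) \<subseteq> B i" "\<delta> < p"
    using hit[of i] \<delta>\<alpha> unfolding sup_eq_def by blast
  obtain \<beta> where \<beta>: "\<beta> \<in> C \<alpha>" "is_pred (C \<alpha>) \<beta> p" "\<beta> \<in> B i" using next_hit[OF lim p(1,2)] by blast
  have p\<beta>: "p < \<beta>" using \<beta>(2) by (simp add: is_pred_def)
  have \<beta>\<alpha>: "\<beta> < \<alpha>" by (rule C_less[OF lim \<beta>(1)])
  have B: "insert (code (True, I, s)) ((\<lambda>z. code (False, I, z)) ` F) \<inter> {..<\<beta>} = A \<beta>"
    "code (True, I, s) < \<beta>" "g p < \<beta>" using \<beta>(3) p\<beta> by (auto simp: B_def i_def)
  have dec: "Ix \<beta> = I" "sq \<beta> = s" "Om \<beta> = {z\<in>F. code (False, I, z) < \<beta>}"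
    by (rule decode_guess[OF fam[OF s] _ B(1,2)], erule Ffam)+

  \<comment> \<open>The positions on level \<open>p\<close> of the walks leading to
    \<open>y'\<close>.\<close>
  define u where "u \<iota> = (if \<iota> \<in> I then br (C \<alpha>) p \<delta> (s \<iota>) else undefined)" for \<iota>
  have u: "u \<in> Func I (T p)"
    using br_in_T[OF lim \<delta>(1) sT, of _ p] p by (auto simp: u_def Func_def)
  have ub: "br (C \<alpha>) \<epsilon> \<delta> (s \<iota>) \<subseteq>\<^sub>m y \<iota>" if "\<iota> \<in> I" "\<epsilon> \<in> C \<alpha>" "\<delta> \<le> \<epsilon>" for \<iota> \<epsilon>
    using br_mono[OF lim \<delta>(1) sT[OF that(1)], of \<epsilon> \<alpha>] that(2,3) C_less[OF lim that(2)] y'y[of \<iota>] y's[OF that(1)] map_le_trans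
    by force
  \<comment> \<open>The element \<open>y\<close> itself lies too high to be guessed at \<beta>, but
    it witnesses that \<open>pick u\<close> is meaningful, and \<beta> is closed under
    \<open>g\<close>.\<close>
  have "above u y" unfolding above_def u_def using ub p y(1) by auto
  then have above: "above u (pick u)" by (rule pick)
  have gu: "code (False, I, pick u) < \<beta>" "ht (pick u) < \<beta>" using g[OF u] B(3) by auto
  have "\<exists>z\<in>Om \<beta>. \<forall>\<iota>\<in>relevant \<beta> (path_nodes f (C \<alpha>) p (br (C \<alpha>) p)) (br (C \<alpha>) p) \<delta>.
    (\<exists>\<epsilon><\<beta>. z \<iota> \<in> T \<epsilon>) \<and> z \<iota> \<subseteq>\<^sub>m br (C \<alpha>) \<beta> \<delta> (sq \<beta> \<iota>)" (is "\<exists>z\<in>_. \<forall>\<iota>\<in>?R. _")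
  proof (rule sealing[OF lim \<beta>(2) \<delta>(1) less_imp_le[OF p(3)] _ _ \<beta>(1)])
    show "pick u \<in> Om \<beta>" unfolding dec using above gu by (simp add: above_def)
    show "(\<exists>\<epsilon><\<beta>. pick u \<iota> \<in> T \<epsilon>) \<and> br (C \<alpha>) p \<delta> (sq \<beta> \<iota>) \<subseteq>\<^sub>m pick u \<iota>" if "\<iota> \<in> Ix \<beta>" for \<iota>
      using that above gu ht[of "pick u" \<iota>] unfolding dec above_def u_def by auto
  qed (use sT inj_s dec in auto)
  then obtain z where z: "z \<in> F" "\<And>\<iota>. \<iota> \<in> ?R \<Longrightarrow> (\<exists>\<epsilon><\<beta>. z \<iota> \<in> T \<epsilon>) \<and> z \<iota> \<subseteq>\<^sub>m br (C \<alpha>) \<beta> \<delta> (s \<iota>)"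
    unfolding dec by blast
  show ?thesis
  proof (rule bexI[OF _ z(1)], rule bexI[OF _ y(1)], intro exI[of _ ?R] conjI ballI impI)
    show RI: "?R \<subseteq> I" using dec by (auto simp: relevant_def)
    show "ext_strict (z \<iota>) (y \<iota>)" if \<iota>R: "\<iota> \<in> ?R" for \<iota>
    proof -
      have \<iota>: "\<iota> \<in> I" using RI \<iota>R by blast
      obtain \<epsilon> where \<epsilon>: "\<epsilon> < \<beta>" "z \<iota> \<in> T \<epsilon>" using z(2)[OF \<iota>R] by blast
      have "\<epsilon> \<noteq> ht y" using \<epsilon>(1) \<beta>\<alpha> y(2) by auto
      then have "z \<iota> \<noteq> y \<iota>" using T_unique[OF \<epsilon>(2)] ht[OF y(1) \<iota>] by metis
      moreover have "z \<iota> \<subseteq>\<^sub>m y \<iota>"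
        using map_le_trans[OF conjunct2[OF z(2)[OF \<iota>R]] ub[OF \<iota> \<beta>(1)]] p(3) p\<beta> by auto
      ultimately show ?thesis by (simp add: ext_strict_def)
    qed
    show "|I - ?R| \<le>o |\<Theta>|"
      by (rule card_not_relevant[OF lim p(1) \<delta>(1) less_imp_le[OF p(3)] dec(1,2) sT inj_s])
    show "?R = I" if "finite I" using that unfolding relevant_def dec by auto
  qed
qed

section \<open>Freeness, antichains and branches\<close>

lemma Tree_free:
  assumes "|\<Theta>| <o \<eta>"
  shows "free Tree \<chi> \<eta>"
  unfolding free_def level_Tree
proof (intro allI impI, elim conjE)
  fix I \<beta> w F
  assume I: "I \<subseteq> Field \<chi>" "I \<noteq> {}" "|I| <o \<chi>" and w: "\<forall>i\<in>I. w i \<in> T \<beta>" "inj_on w I"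
    and F: "F \<subseteq> derived_tree Tree I w" "|F| =o |UNIV :: 'a set|"
  have wT: "\<And>i. i \<in> I \<Longrightarrow> w i \<in> T \<beta>" using w(1) by blast
  obtain x y R where xy: "x \<in> F" "y \<in> F" "\<forall>\<iota>\<in>R. ext_strict (x \<iota>) (y \<iota>)" "|I - R| \<le>o |\<Theta>|"
    using sealed_pair[OF I wT w(2) F] by blast
  have "|{i\<in>I. \<not> ext_strict (x i) (y i)}| \<le>o |I - R|"
    by (rule card_of_mono1) (use xy in auto)
  then have "|{i\<in>I. \<not> ext_strict (x i) (y i)}| <o \<eta>"
    using xy(4) assms ordLeq_transitive ordLeq_ordLess_trans by blast
  then show "\<exists>x\<in>F. \<exists>y\<in>F. |{i\<in>I. \<not> ext_strict (x i) (y i)}| <o \<eta>" using xy by blast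
qed

text \<open>A node is viewed as a family with one index over the root. Finite families are sealed in
  full, so \<kappa> many nodes contain a comparable pair.\<close>

lemma antichain_small:
  assumes N: "N \<subseteq> Tree" "\<And>x y. x \<in> N \<Longrightarrow> y \<in> N \<Longrightarrow> x \<noteq> y \<Longrightarrow> \<not> compat x y"
  shows "|N| <o |UNIV :: 'a set|"
proof (rule ccontr)
  assume "\<not> |N| <o |UNIV :: 'a set|"
  then have "|UNIV :: 'a set| \<le>o |N|" by (simp add: not_ordLess_iff_ordLeq card_of_Well_order)
  then obtain e :: "'a \<Rightarrow> _" where e: "inj e" "range e \<subseteq> N" by (auto simp: card_of_ordLeq[symmetric])
  obtain c where c: "c \<in> Field \<chi>" using inf_\<chi> by fastforce
  define G where "G x = (\<lambda>\<iota>. if \<iota> = c then x else undefined)" for x :: "'a node"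
  obtain z :: 'a where z: "\<And>\<gamma>. \<not> \<gamma> < z" using not_less_Least[of _ "\<lambda>_. True"] by blast
  have inj: "inj (\<lambda>a. G (e a))"
  proof (rule injI)
    fix a b assume "G (e a) = G (e b)"
    then have "e a = e b" unfolding G_def by (metis (full_types))
    then show "a = b" using e(1) by (auto dest: injD)
  qed
  then have card: "|range (\<lambda>a. G (e a))| =o |UNIV :: 'a set|"
    using card_of_ordIsoI[of "\<lambda>a. G (e a)" UNIV] ordIso_symmetric by (auto simp: bij_betw_def)
  have fin: "|{c}| <o \<chi>"
    by (rule finite_ordLess_infinite[OF card_of_Well_order])
      (use card_\<chi> inf_\<chi> in \<open>auto simp: Field_card_of card_order_on_well_order_on\<close>)
  have sub: "range (\<lambda>a. G (e a)) \<subseteq> derived_tree Tree {c} (\<lambda>_. Map.empty)"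
  proof (clarify)
    fix a
    have "e a \<in> Tree" using e N by blast
    moreover from this obtain \<alpha> where "dom (e a) = {..<\<alpha>}" using T_dom by (auto simp: Tree_def)
    ultimately show "G (e a) \<in> derived_tree Tree {c} (\<lambda>_. Map.empty)"
      by (auto simp: derived_tree_def Func_def G_def compat_def)
  qed
  have w: "Map.empty \<in> T z" using T_zero z by blast
  have I: "{c} \<subseteq> Field \<chi>" "{c} \<noteq> {}" using c by auto
  have inj0: "inj_on (\<lambda>_. Map.empty) {c}" by simp
  have "\<exists>x\<in>range (\<lambda>a. G (e a)). \<exists>y\<in>range (\<lambda>a. G (e a)). ext_strict (x c) (y c)"
    using sealed_pair[OF I fin w inj0 sub card] by blast
  then obtain x y where xy: "x \<in> range (\<lambda>a. G (e a))" "y \<in> range (\<lambda>a. G (e a))" "ext_strict (x c) (y c)"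
    by blast
  moreover have "x c \<in> N" "y c \<in> N" using xy(1,2) e(2) by (auto simp: G_def)
  ultimately show False using N(2)[of "x c" "y c"] by (auto simp: ext_strict_def compat_def)
qed

lemma no_cofinal_branch:
  assumes N: "N \<subseteq> Tree" "\<And>x y. x \<in> N \<Longrightarrow> y \<in> N \<Longrightarrow> compat x y" "\<And>\<alpha>. N \<inter> T \<alpha> \<noteq> {}"
  shows False
proof -
  have "\<forall>\<alpha>. \<exists>x. x \<in> N \<and> x \<in> T \<alpha>" using N(3) by blast
  from choice[OF this] obtain b where b: "\<And>\<alpha>. b \<alpha> \<in> N \<and> b \<alpha> \<in> T \<alpha>" by blast
  have dom_b: "dom (b \<alpha>) = {..<\<alpha>}" for \<alpha> using T_dom b by blast
  have b_le: "b \<alpha> \<subseteq>\<^sub>m b \<beta>" if "\<alpha> \<le> \<beta>" for \<alpha> \<beta>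
  proof -
    have "compat (b \<alpha>) (b \<beta>)" using N(2) b by blast
    moreover have "dom (b \<alpha>) \<subseteq> dom (b \<beta>)" unfolding dom_b using that by auto
    ultimately show ?thesis unfolding compat_def by (metis map_le_same_dom map_le_implies_dom_le order_antisym map_le_refl)
  qed
  have "\<exists>i0 i1::'a. i0 \<noteq> i1 \<and> finite {..<i0} \<and> finite {..<i1}"
  proof -
    obtain z :: 'a where z: "\<And>\<gamma>. \<not> \<gamma> < z" using not_less_Least[of _ "\<lambda>_. True"] by blast
    obtain o' where o': "is_pred UNIV o' z"
      using unbounded[of z] unfolding is_pred_def by (metis LeastI UNIV_I not_le not_less_Least)
    have "{..<o'} \<subseteq> {z}" using o' z by (auto simp: is_pred_def intro: order_antisym simp: not_less)
    then have "finite {..<o'}" by (rule finite_subset) simp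
    moreover have "{..<z} = {}" using z by auto
    ultimately show ?thesis using o' by (metis finite.emptyI is_pred_def less_irrefl)
  qed
  then obtain i0 i1 :: 'a where i: "i0 \<noteq> i1" "finite {..<i0}" "finite {..<i1}" by blast
  have "\<exists>j. finite {..<j} \<and> (\<forall>\<beta>>\<alpha>. b \<beta> \<alpha> \<noteq> Some j)" for \<alpha>
  proof -
    obtain \<gamma> where \<gamma>: "\<alpha> < \<gamma>" using unbounded by blast
    have *: "b \<beta> \<alpha> = b \<gamma> \<alpha>" if "\<alpha> < \<beta>" for \<beta>
    proof -
      have dom: "\<alpha> \<in> dom (b \<beta>)" "\<alpha> \<in> dom (b \<gamma>)" unfolding dom_b using that \<gamma> by auto
      show ?thesis
      proof (cases "\<beta> \<le> \<gamma>")
        case True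
        show ?thesis using bspec[OF b_le[OF True, unfolded map_le_def] dom(1)] .
      next
        case False
        then have le: "\<gamma> \<le> \<beta>" by simp
        show ?thesis using bspec[OF b_le[OF le, unfolded map_le_def] dom(2)] by simp
      qed
    qed
    obtain j where "finite {..<j}" "b \<gamma> \<alpha> \<noteq> Some j" 
      using i by (cases "b \<gamma> \<alpha> = Some i0") auto
    then show ?thesis using * by auto
  qed
  then have "\<forall>\<alpha>. \<exists>j. finite {..<j} \<and> (\<forall>\<beta>>\<alpha>. b \<beta> \<alpha> \<noteq> Some j)" by blast
  from choice[OF this] obtain j
    where j: "\<And>\<alpha>. finite {..<j \<alpha>}" "\<And>\<alpha> \<beta>. \<alpha> < \<beta> \<Longrightarrow> b \<beta> \<alpha> \<noteq> Some (j \<alpha>)" by blast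
  define n where "n \<alpha> = (b \<alpha>)(\<alpha> \<mapsto> j \<alpha>)" for \<alpha>
  have nT: "n \<alpha> \<in> Tree" for \<alpha>
    using Tree_prolific j(1) b unfolding prolific_def level_Tree n_def by blast
  have nn: "\<not> compat (n \<alpha>) (n \<beta>)" if "\<alpha> < \<beta>" for \<alpha> \<beta>
  proof -
    have "n \<alpha> \<alpha> = Some (j \<alpha>)" by (simp add: n_def)
    moreover have "n \<beta> \<alpha> = b \<beta> \<alpha>" using that by (auto simp: n_def)
    ultimately have "n \<alpha> \<alpha> \<noteq> n \<beta> \<alpha>" using j(2)[OF that] by simp
    moreover have "\<alpha> \<in> dom (n \<alpha>)" "\<alpha> \<in> dom (n \<beta>)" using that dom_b[of \<beta>] by (auto simp: n_def)
    ultimately show ?thesis unfolding compat_def map_le_def by metis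
  qed
  have inj: "inj n"
  proof (rule injI)
    fix \<alpha> \<beta> assume "n \<alpha> = n \<beta>"
    then have "compat (n \<alpha>) (n \<beta>)" "compat (n \<beta>) (n \<alpha>)" by (simp_all add: compat_def)
    then show "\<alpha> = \<beta>" using nn linorder_neqE by blast
  qed
  have "|range n| <o |UNIV :: 'a set|"
  proof (rule antichain_small)
    show "range n \<subseteq> Tree" using nT by blast
    fix x y assume "x \<in> range n" "y \<in> range n" "x \<noteq> y"
    then obtain \<alpha> \<beta> where "x = n \<alpha>" "y = n \<beta>" "\<alpha> \<noteq> \<beta>" by blast
    then show "\<not> compat x y" using nn[of \<alpha> \<beta>] nn[of \<beta> \<alpha>] unfolding compat_def by (metis linorder_neqE)
  qed
  moreover have "|UNIV :: 'a set| \<le>o |range n|" by (rule card_of_ordLeqI[OF inj]) simp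
  ultimately show False using not_ordLess_ordLeq by blast
qed

lemma Tree_souslin: "souslin Tree"
  unfolding souslin_def level_Tree
proof (intro conjI allI impI)
  show "T \<alpha> \<noteq> {}" for \<alpha>
    using inf_\<Theta> f_in_T by (metis empty_iff finite.emptyI ex_in_conv)
  show "|T \<alpha>| <o |UNIV :: 'a set|" for \<alpha> by (rule T_small)
  show "\<not> (\<exists>B\<subseteq>Tree. (\<forall>x\<in>B. \<forall>y\<in>B. compat x y) \<and> (\<forall>\<alpha>. B \<inter> T \<alpha> \<noteq> {}))"
    using no_cofinal_branch by blast
  show "|N| <o |UNIV :: 'a set|" if "N \<subseteq> Tree" "\<forall>x\<in>N. \<forall>y\<in>N. x \<noteq> y \<longrightarrow> \<not> compat x y" for N
    using antichain_small that by blast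
qed

end

section \<open>Choice of the parameters\<close>

theorem theorem6p1:
  fixes \<chi> :: "'c rel" and \<theta> :: "'d rel"
  assumes "kappa_regular_uncountable TYPE('a::wellorder)"
    and "Card_order \<chi>"
    and "P14 (E_ge \<chi> :: 'a set)"
    and "small_below TYPE('a) \<chi>"
    and "Card_order \<theta>" and "\<not> finite (Field \<theta>)"
    and "cardSuc \<theta> <o \<chi>"
  shows "\<exists>T :: 'a node set. downward_closed_tree T \<and> prolific T \<and> slim T
           \<and> free T \<chi> (cardSuc \<theta>) \<and> souslin T
           \<and> (\<exists>f. injective_fin_ascent_path T (Field \<theta>) f)"
proof -
  note K = assms(1)
  have dia: "diamond TYPE('a)" using assms(3) by (simp add: P14_def)
  then obtain A :: "'a \<Rightarrow> 'a set" where A: "\<And>Z. stationary {\<alpha>. Z \<inter> {..<\<alpha>} = A \<alpha>}"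
    by (auto simp: diamond_def)
  obtain C :: "'a \<Rightarrow> 'a set" where C: "\<And>\<alpha>. is_limit \<alpha> \<Longrightarrow> club_in (C \<alpha>) \<alpha>"
      "\<And>\<alpha> \<alpha>'. \<alpha>' \<in> acc (C \<alpha>) \<Longrightarrow> C \<alpha>' = C \<alpha> \<inter> {..<\<alpha>'}"
      "\<And>B. (\<And>i \<beta>. \<exists>a\<in>B i. \<beta> < a) \<Longrightarrow>
      stationary {\<alpha>\<in>E_ge \<chi>. \<forall>i<\<alpha>. sup_eq {\<beta>\<in>C \<alpha>. succ_omega (C \<alpha> - {..<\<beta>}) \<subseteq> B i} \<alpha>}"
    using assms(3) unfolding P14_def by blast
  have "stationary (E_ge \<chi> :: 'a set)"
    using C(3)[of "\<lambda>_. UNIV"] kappa_unbounded[OF K] unfolding stationary_def by blast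
  \<comment> \<open>Any point of cofinality at least \<chi> has at least \<chi> predecessors, hence
    room below it for an injection \<open>h\<close> from \<theta>.\<close>
  then obtain d0 :: 'a where d0: "d0 \<in> E_ge \<chi>" using stationary_closure_point[OF K] by blast
  then have \<chi>d0: "\<chi> \<le>o |{..<d0}|" by (auto simp: E_ge_def)
  have \<theta>\<chi>: "\<theta> <o \<chi>" using cardSuc_greater[OF assms(5)] assms(7) ordLess_transitive by blast
  have F\<theta>: "|Field \<theta>| =o \<theta>" using assms(5) by (rule card_of_Field_ordIso)
  have F\<chi>: "|Field \<chi>| =o \<chi>" using assms(2) by (rule card_of_Field_ordIso)
  have "|Field \<theta>| \<le>o |{..<d0}|"
    using F\<theta> \<theta>\<chi> \<chi>d0 ordIso_ordLeq_trans ordLess_imp_ordLeq ordLeq_transitive by blast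
  then obtain h where h: "inj_on h (Field \<theta>)" "h ` Field \<theta> \<subseteq> {..<d0}"
    by (auto simp: card_of_ordLeq[symmetric])
  have "|Field \<theta>| \<le>o |Field \<chi>|"
    using F\<theta> \<theta>\<chi> F\<chi> by (meson ordIso_ordLeq_trans ordIso_symmetric ordLeq_ordIso_trans ordLess_imp_ordLeq)
  then have inf: "infinite (Field \<chi>)" using assms(6) card_of_ordLeq_infinite by blast
  have \<chi>K: "\<chi> <o |UNIV :: 'a set|" using \<chi>d0 kappa_initial[OF K] by (rule ordLeq_ordLess_trans)
  have "|families \<chi> :: ('c set \<times> ('c \<Rightarrow> 'a node)) set| \<le>o
      |{(I, s). I \<subseteq> Field \<chi> \<and> |I| <o |UNIV :: 'a set| \<and> s \<in> Func I (nodes :: 'a node set)}|"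
    by (rule card_of_mono1) (use \<chi>K ordLess_transitive in \<open>auto simp: families_def\<close>)
  moreover have "|{(I, s). I \<subseteq> Field \<chi> \<and> |I| <o |UNIV :: 'a set| \<and> s \<in> Func I (nodes :: 'a node set)}|
      \<le>o |UNIV :: 'a set|"
    by (rule card_small_functions[OF K dia _ card_nodes[OF K dia]])
      (use F\<chi> \<chi>K ordIso_ordLess_trans ordLess_imp_ordLeq in blast)
  ultimately have fam: "|families \<chi> :: ('c set \<times> ('c \<Rightarrow> 'a node)) set| \<le>o |UNIV :: 'a set|"
    by (rule ordLeq_transitive)
  have "|UNIV :: bool set| \<le>o |UNIV :: 'a set|"
    using countable_small[OF K, of "UNIV :: bool set"] ordLess_imp_ordLeq by auto
  then have "|(UNIV :: bool set) \<times> (families \<chi> :: ('c set \<times> ('c \<Rightarrow> 'a node)) set)| \<le>o |UNIV :: 'a set|"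
    using card_of_Times_ordLeq_infinite_Field[OF _ _ fam card_of_Card_order] kappa_infinite[OF K]
    by (simp add: Field_card_of)
  then obtain code :: "bool \<times> 'c set \<times> ('c \<Rightarrow> 'a node) \<Rightarrow> 'a"
    where code: "inj_on code (UNIV \<times> families \<chi>)" by (auto simp: card_of_ordLeq[symmetric])
  \<comment> \<open>Without a unique head the value is arbitrary; \<open>decode\<close> makes no
    demand then.\<close>
  define dec where "dec \<beta> = (THE w. w \<in> families \<chi> \<and> code (True, w) \<in> A \<beta>)" for \<beta>
  define Om where "Om \<beta> = {z. (fst (dec \<beta>), z) \<in> families \<chi> \<and> code (False, fst (dec \<beta>), z) \<in> A \<beta>}" for \<beta>
  interpret guided_construction C "\<lambda>\<beta>. fst (dec \<beta>)" "\<lambda>\<beta>. snd (dec \<beta>)" Om d0 "Field \<theta>" h \<chi> A code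
  proof
    fix \<beta> I s assume eq: "{w \<in> families \<chi>. code (True, w) \<in> A \<beta>} = {(I, s)}"
    have "dec \<beta> = (I, s)" unfolding dec_def by (rule the_equality) (use eq in auto)
    then show "fst (dec \<beta>) = I \<and> snd (dec \<beta>) = s \<and> Om \<beta> = {z. (I, z) \<in> families \<chi> \<and> code (False, I, z) \<in> A \<beta>}"
      by (simp add: Om_def)
  qed (use K assms C A h inf code kappa_unbounded[OF K] in auto)
  have "|Field \<theta>| <o cardSuc \<theta>"
    using F\<theta> cardSuc_greater[OF assms(5)] by (rule ordIso_ordLess_trans)
  then show ?thesis
    using Tree_downward_closed Tree_prolific Tree_slim Tree_free Tree_souslin Tree_ascent_path by blast
qed

end
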